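(* Let $C_n$ be the cycle graph on $n$ vertices ($n\ge 3$). Then $\mathbb{H}_*(C_n)\cong\widetilde{\mathrm{H}}_{n-1-*}(S^1)$, where $\mathbb{H}$ is bold homology and $\widetilde{\mathrm{H}}$ is reduced singular (simplicial) homology, both with coefficients in a field $\mathbb{K}$.
   Context: Bold homology. Let $G$ be a finite simple graph and $\mathbb{K}$ a field; order $V(G)$. A bi-colouring is a map $\varepsilon\colon V(G)\to\{0,1\}$, and $G_\varepsilon$ denotes the subgraph of $G$ induced by the vertices $v$ with $\varepsilon(v)=1$. Write $\varepsilon\,\widetilde{\triangleleft}\,\varepsilon'$ if $\varepsilon'$ is obtained from $\varepsilon$ by changing the value at exactly one vertex from $0$ to $1$. A sign assignment is a choice of $s(\varepsilon,\varepsilon')\in\mathbb{Z}/2$ for each such pair with $s(\varepsilon,\varepsilon_1)+s(\varepsilon_1,\varepsilon'')\equiv s(\varepsilon,\varepsilon_2)+s(\varepsilon_2,\varepsilon'')+1\pmod 2$ whenever $\varepsilon\,\widetilde{\triangleleft}\,\varepsilon_1,\varepsilon_2\,\widetilde{\triangleleft}\,\varepsilon''$, $\varepsilon_1\neq\varepsilon_2$; it exists and the choice does not affect the complex up to isomorphism. The bold chain group is \[\mathrm{C}\mathbb{H}_i(G)=\bigoplus_{\varepsilon:\ \sum_v\varepsilon(v)=i}\ \bigoplus_{x\in\pi_0(G_\varepsilon)}\mathbb{K}\langle x\rangle,\] where $\pi_0$ is the set of connected components (so $\mathrm{C}\mathbb{H}_0=0$), with differential $d^i\colon \mathrm{C}\mathbb{H}_i\to\mathrm{C}\mathbb{H}_{i+1}$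 given for $x\in\pi_0(G_\varepsilon)$ by $d^i(x)=\sum(-1)^{s(\varepsilon,\varepsilon')}y$, the sum over all $\varepsilon'$ with $\varepsilon\,\widetilde{\triangleleft}\,\varepsilon'$ and the component $y\in\pi_0(G_{\varepsilon'})$ with $V(x)\subseteq V(y)$. Its homology is the bold homology $\mathbb{H}_*(G)$. *)

theory Defs
  imports "HOL-Homology.Homology" "HOL-Algebra.Module" "HOL-Library.Z2"
begin

section \<open>Chain complexes with chosen bases over a field\<close>

text \<open>
  The free vector space over a field \<open>'k\<close> on a set \<open>B\<close> consists of the finitely supported
  functions \<open>c :: 'b \<Rightarrow>\<^sub>0 'k\<close> with \<open>Poly_Mapping.keys c \<subseteq> B\<close>. The next two functions are
  the versions over \<open>'k\<close> of \<^const>\<open>frag_cmul\<close> and \<^const>\<open>frag_extend\<close>.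
\<close>

definition lin_scale :: "'k::field \<Rightarrow> ('b \<Rightarrow>\<^sub>0 'k) \<Rightarrow> ('b \<Rightarrow>\<^sub>0 'k)"
  where "lin_scale a c = Poly_Mapping.map (\<lambda>x. a * x) c"

definition lin_extend :: "('b \<Rightarrow> ('c \<Rightarrow>\<^sub>0 'k)) \<Rightarrow> ('b \<Rightarrow>\<^sub>0 'k::field) \<Rightarrow> ('c \<Rightarrow>\<^sub>0 'k)"
  where "lin_extend f c = (\<Sum>b\<in>Poly_Mapping.keys c. lin_scale (Poly_Mapping.lookup c b) (f b))"

text \<open>
  The homology at the middle term of \<open>'k\<langle>A\<rangle> \<rightarrow> 'k\<langle>B\<rangle> \<rightarrow> \<dots>\<close>, where the incoming and the
  outgoing map are the linear extensions of \<open>f\<close> and \<open>g\<close>: the vector space of cosets of the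
  boundaries in the cycles. Adding the boundaries in \<open>smult\<close> matters for the scalar \<open>0\<close> only.
  The fields \<open>mult\<close> and \<open>one\<close> of the record have no meaning for modules.
\<close>

definition homology_space ::
  "'b set \<Rightarrow> ('b \<Rightarrow> ('b \<Rightarrow>\<^sub>0 'k)) \<Rightarrow> 'b set \<Rightarrow> ('b \<Rightarrow> ('b \<Rightarrow>\<^sub>0 'k)) \<Rightarrow> ('k::field, ('b \<Rightarrow>\<^sub>0 'k) set) module"
  where "homology_space A f B g =
    (let cycles = {c. Poly_Mapping.keys c \<subseteq> B \<and> lin_extend g c = 0};
         boundaries = lin_extend f ` {c. Poly_Mapping.keys c \<subseteq> A}
     in \<lparr> carrier = (\<lambda>z. {z + b |b. b \<in> boundaries}) ` cycles,
          mult = undefined, one = undefined,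
          zero = boundaries,
          add = (\<lambda>X Y. {x + y |x y. x \<in> X \<and> y \<in> Y}),
          smult = (\<lambda>a X. {lin_scale a x + b |x b. x \<in> X \<and> b \<in> boundaries}) \<rparr>)"

definition lin_isomorphic ::
  "('k::field, 'v) module \<Rightarrow> ('k, 'w) module \<Rightarrow> bool"
  where "lin_isomorphic M N \<longleftrightarrow>
    (\<exists>h. bij_betw h (carrier M) (carrier N) \<and>
         (\<forall>x\<in>carrier M. \<forall>y\<in>carrier M. h (x \<oplus>\<^bsub>M\<^esub> y) = h x \<oplus>\<^bsub>N\<^esub> h y) \<and>
         (\<forall>a. \<forall>x\<in>carrier M. h (a \<odot>\<^bsub>M\<^esub> x) = a \<odot>\<^bsub>N\<^esub> h x))"


section \<open>Reduced singular homology with coefficients in a field\<close>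

text \<open>
  The library's singular homology has integer coefficients. The reduced theory is the homology of
  the augmented singular complex, whose term in degree \<open>-1\<close> is \<open>'k\<close>, spanned by the unique
  extensional map on the empty simplex, \<open>\<lambda>_. undefined\<close>.
\<close>

definition singular_basis :: "'a topology \<Rightarrow> int \<Rightarrow> ((nat \<Rightarrow> real) \<Rightarrow> 'a) set"
  where "singular_basis X p =
    (if p \<ge> 0 then singular_simplex_set (nat p) X
     else if p = -1 then {\<lambda>_. undefined}
     else {})"

definition singular_bd :: "int \<Rightarrow> ((nat \<Rightarrow> real) \<Rightarrow> 'a) \<Rightarrow> (((nat \<Rightarrow> real) \<Rightarrow> 'a) \<Rightarrow>\<^sub>0 'k::field)"
  where "singular_bd p \<sigma> =
    (if p \<ge> 1 then \<Sum>k\<le>nat p. Poly_Mapping.single (singular_face (nat p) k \<sigma>) ((-1) ^ k)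
     else if p = 0 then Poly_Mapping.single (\<lambda>_. undefined) 1
     else 0)"

definition reduced_singular_homology ::
  "int \<Rightarrow> 'a topology \<Rightarrow> ('k::field, (((nat \<Rightarrow> real) \<Rightarrow> 'a) \<Rightarrow>\<^sub>0 'k) set) module"
  where "reduced_singular_homology p X =
    homology_space (singular_basis X (p + 1)) (singular_bd (p + 1))
                   (singular_basis X p) (singular_bd p)"


section \<open>Bold homology\<close>

definition simple_graph :: "'a set \<Rightarrow> 'a rel \<Rightarrow> bool"
  where "simple_graph V E \<longleftrightarrow> finite V \<and> E \<subseteq> V \<times> V \<and> sym E \<and> irrefl E"

text \<open>
  A bi-colouring \<open>\<epsilon> : V \<rightarrow> {0, 1}\<close> is represented by the set \<open>S \<subseteq> V\<close> of vertices with value \<open>1\<close>.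
\<close>

definition colour_step :: "'a set \<Rightarrow> 'a set \<Rightarrow> 'a set \<Rightarrow> bool"
  where "colour_step V S T \<longleftrightarrow> S \<subseteq> V \<and> (\<exists>v\<in>V - S. T = insert v S)"

definition sign_assignment :: "'a set \<Rightarrow> ('a set \<Rightarrow> 'a set \<Rightarrow> bit) \<Rightarrow> bool"
  where "sign_assignment V s \<longleftrightarrow>
    (\<forall>S T\<^sub>1 T\<^sub>2 U. colour_step V S T\<^sub>1 \<and> colour_step V T\<^sub>1 U \<and>
                  colour_step V S T\<^sub>2 \<and> colour_step V T\<^sub>2 U \<and> T\<^sub>1 \<noteq> T\<^sub>2 \<longrightarrow>
       s S T\<^sub>1 + s T\<^sub>1 U = s S T\<^sub>2 + s T\<^sub>2 U + 1)"

definition induced_components :: "'a rel \<Rightarrow> 'a set \<Rightarrow> 'a set set"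
  where "induced_components E S = S // {(u, v) \<in> S \<times> S. (u, v) \<in> (E \<inter> S \<times> S)\<^sup>*}"

definition bold_basis :: "'a set \<Rightarrow> 'a rel \<Rightarrow> int \<Rightarrow> ('a set \<times> 'a set) set"
  where "bold_basis V E i = {(S, x). S \<subseteq> V \<and> int (card S) = i \<and> x \<in> induced_components E S}"

definition bold_diff ::
  "'a set \<Rightarrow> 'a rel \<Rightarrow> ('a set \<Rightarrow> 'a set \<Rightarrow> bit) \<Rightarrow>
    'a set \<times> 'a set \<Rightarrow> ('a set \<times> 'a set \<Rightarrow>\<^sub>0 'k::field)"
  where "bold_diff V E s = (\<lambda>(S, x).
    \<Sum>(T, y) \<in> {(T, y). colour_step V S T \<and> y \<in> induced_components E T \<and> x \<subseteq> y}.
      Poly_Mapping.single (T, y) (if s S T = 0 then 1 else - 1))"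

definition bold_homology ::
  "'a set \<Rightarrow> 'a rel \<Rightarrow> ('a set \<Rightarrow> 'a set \<Rightarrow> bit) \<Rightarrow> int \<Rightarrow>
    ('k::field, ('a set \<times> 'a set \<Rightarrow>\<^sub>0 'k) set) module"
  where "bold_homology V E s i =
    homology_space (bold_basis V E (i - 1)) (bold_diff V E s)
                   (bold_basis V E i) (bold_diff V E s)"

definition cycle_edges :: "nat \<Rightarrow> nat rel"
  where "cycle_edges n =
    {(i, j). i < n \<and> j < n \<and> (j = (i + 1) mod n \<or> i = (j + 1) mod n)}"


section \<open>Basic properties\<close>

lemma simple_graph_cycle:
  assumes "n \<ge> 3"
  shows "simple_graph {..<n} (cycle_edges n)"
  using assms
  by (auto simp: simple_graph_def cycle_edges_def sym_def irrefl_def mod_Suc)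

lemma sign_assignment_exists:
  fixes V :: "'a::linorder set"
  assumes "finite V"
  shows "\<exists>s. sign_assignment V s"
proof -
  define c where "c S v = (of_nat (card {u\<in>S. u < v}) :: bit)" for S :: "'a set" and v
  define s where "s S T = c S (THE v. T - S = {v})" for S T
  have s: "s S (insert v S) = c S v" if "v \<notin> S" for S v
  proof -
    have "insert v S - S = {v}" using that by auto
    thus ?thesis by (simp add: s_def)
  qed
  have c: "c (insert v S) w = c S w + (if v < w then 1 else 0)"
    if "v \<notin> S" "S \<subseteq> V" for S v w
  proof -
    have "finite S" using that assms finite_subset by blast
    moreover have "{u \<in> insert v S. u < w} =
        (if v < w then insert v {u\<in>S. u < w} else {u\<in>S. u < w})" by auto
    ultimately show ?thesis using that by (simp add: c_def add.commute)
  qed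
  have "s S T1 + s T1 U = s S T2 + s T2 U + 1"
    if st: "colour_step V S T1" "colour_step V T1 U" "colour_step V S T2" "colour_step V T2 U"
      "T1 \<noteq> T2" for S T1 T2 U
  proof -
    obtain v where v: "v \<in> V - S" "T1 = insert v S" "S \<subseteq> V" using st(1) by (auto simp: colour_step_def)
    obtain w where w: "w \<in> V - S" "T2 = insert w S" using st(3) by (auto simp: colour_step_def)
    have vw: "v \<noteq> w" using v w st(5) by auto
    obtain a where a: "U = insert a T1" using st(2) by (auto simp: colour_step_def)
    have "w \<in> U" using st(4) w by (auto simp: colour_step_def)
    hence U1: "U = insert w T1" using a v w vw by auto
    have U2: "U = insert v T2" using U1 v w by auto
    have "s S T1 + s T1 U = c S v + (c S w + (if v < w then 1 else 0))"
      using v w vw s[of v S] s[of w T1] c[of v S w] U1 by auto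
    moreover have "s S T2 + s T2 U = c S w + (c S v + (if w < v then 1 else 0))"
      using v w vw s[of w S] s[of v T2] c[of w S v] U2 by auto
    ultimately show ?thesis using vw by (cases "v < w") (auto simp: algebra_simps)
  qed
  thus ?thesis unfolding sign_assignment_def by blast
qed

end

theory Submission
  imports Defs
begin

text \<open>
  Each side is one-dimensional in a single degree, bold degree \<open>n - 2\<close> and degree \<open>1\<close> of the circle,
  and zero in all others; \<open>i \<mapsto> n - 1 - i\<close> exchanges these two degrees. In every degree, homology is
  described by a linear functional on the cycles that vanishes exactly on the boundaries, and two
  homology spaces with such functionals are isomorphic as soon as the functionals have the same
  range (\<open>lin_isomorphic_if_same_range\<close>).

  On the bold side, a proper induced subgraph of the cycle is a forest, so for its vertex set \<open>S\<close> the
  sequence \<open>0 \<rightarrow> K\<langle>edges\<rangle> \<rightarrow> K\<langle>vertices\<rangle> \<rightarrow> K\<langle>components\<rangle> \<rightarrow> 0\<close> is exact. It is exact for the whole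
  cycle too, except that the kernel on the left is then spanned by the sum of all edges, the
  fundamental cycle. For varying \<open>S\<close>, the vertices form a sum of complexes, one for each vertex \<open>v\<close>: a
  copy of \<open>K\<close> at each \<open>S\<close> containing \<open>v\<close>. In the same way each edge contributes a copy of \<open>K\<close> at each \<open>S\<close>
  containing both of its ends. These are faces of a cube, and each is acyclic (\<open>cube_exact\<close>), since a
  vertex or an edge leaves some vertex free when \<open>n \<ge> 3\<close>. Hence bold homology is that of the remaining
  term, the fundamental cycle in degree \<open>n\<close>, moved down by the two steps of the exact sequence. The
  relation \<open>winding\<close> follows these two steps at the level of chains, and its values are the functional
  (\<open>bold_homology_cycle_graph\<close>).

  On the singular side, the integral homology of spheres is known, and it has to be transferred to
  the field. The reduced integral homology groups are free, being \<open>0\<close> or \<open>\<int>\<close>. Hence on every simplex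
  one can choose, degree by degree, a chain homotopy \<open>h\<close> with \<open>\<partial>h\<sigma> = \<sigma> - h\<partial>\<sigma> - m(\<sigma>)z\<close>, where \<open>z\<close>
  generates the homology (\<open>homotopy_off_exists\<close>). As the singular simplices are a basis, this formula
  extends linearly over every field, where it says that each cycle \<open>c\<close> is homologous to \<open>m(c)z\<close>
  (\<open>field_homology_nsphere\<close>).
\<close>

section \<open>Linear extension over a field\<close>

lemma lookup_lin_scale [simp]:
  "Poly_Mapping.lookup (lin_scale a c) b = a * Poly_Mapping.lookup c b"
  by (simp add: lin_scale_def Poly_Mapping.map.rep_eq when_def)

lemma lin_scale_0 [simp]: "lin_scale 0 c = 0" "lin_scale a 0 = 0"
  by (simp_all add: poly_mapping_eqI)

lemma lin_scale_1 [simp]: "lin_scale 1 c = c"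
  by (simp add: poly_mapping_eqI)

lemma keys_lin_scale: "Poly_Mapping.keys (lin_scale a c) \<subseteq> Poly_Mapping.keys c"
  by (auto simp: in_keys_iff)

lemma lookup_lin_extend_superset:
  assumes "finite B" "Poly_Mapping.keys c \<subseteq> B"
  shows "Poly_Mapping.lookup (lin_extend f c) y =
    (\<Sum>b\<in>B. Poly_Mapping.lookup c b * Poly_Mapping.lookup (f b) y)"
proof -
  have "Poly_Mapping.lookup (lin_extend f c) y =
      (\<Sum>b\<in>Poly_Mapping.keys c. Poly_Mapping.lookup c b * Poly_Mapping.lookup (f b) y)"
    by (simp add: lin_extend_def lookup_sum)
  also have "\<dots> = (\<Sum>b\<in>B. Poly_Mapping.lookup c b * Poly_Mapping.lookup (f b) y)"
    using assms by (intro sum.mono_neutral_left) (auto simp: in_keys_iff)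
  finally show ?thesis .
qed

lemmas lookup_lin_extend = lookup_lin_extend_superset [OF finite_keys subset_refl]

lemma lin_extend_0 [simp]: "lin_extend f 0 = 0"
  by (simp add: lin_extend_def)

lemma lin_extend_add: "lin_extend f (c + d) = lin_extend f c + lin_extend f d"
proof (rule poly_mapping_eqI)
  fix y
  let ?B = "Poly_Mapping.keys c \<union> Poly_Mapping.keys d"
  show "Poly_Mapping.lookup (lin_extend f (c + d)) y =
      Poly_Mapping.lookup (lin_extend f c + lin_extend f d) y"
    using keys_add [of c d]
    by (simp add: lookup_lin_extend_superset [of ?B] lookup_add sum.distrib algebra_simps)
qed

lemma lin_extend_lin_scale: "lin_extend f (lin_scale a c) = lin_scale a (lin_extend f c)"
proof (rule poly_mapping_eqI)
  fix y
  show "Poly_Mapping.lookup (lin_extend f (lin_scale a c)) y =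
      Poly_Mapping.lookup (lin_scale a (lin_extend f c)) y"
    using keys_lin_scale [of a c]
    by (simp add: lookup_lin_extend_superset [of "Poly_Mapping.keys c"] sum_distrib_left mult.assoc)
qed

lemma uminus_eq_lin_scale: "- c = lin_scale (- 1) c"
  by (simp add: poly_mapping_eqI)

lemma lin_extend_diff: "lin_extend f (c - d) = lin_extend f c - lin_extend f d"
  using lin_extend_add [of f c "- d"]
  by (simp add: uminus_eq_lin_scale [of d] lin_extend_lin_scale)
     (simp flip: uminus_eq_lin_scale)

lemma lin_extend_single: "lin_extend f (Poly_Mapping.single b a) = lin_scale a (f b)"
  by (rule poly_mapping_eqI) (simp add: lookup_lin_extend_superset [of "{b}"])

lemma lin_extend_cong:
  assumes "\<And>b. b \<in> Poly_Mapping.keys c \<Longrightarrow> f b = g b"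
  shows "lin_extend f c = lin_extend g c"
  using assms by (simp add: lin_extend_def)

lemma lin_extend_eq_0:
  assumes "\<And>b. b \<in> Poly_Mapping.keys c \<Longrightarrow> f b = 0"
  shows "lin_extend f c = 0"
  using assms by (simp add: lin_extend_def)

lemma lin_extend_sum: "lin_extend f (\<Sum>i\<in>I. c i) = (\<Sum>i\<in>I. lin_extend f (c i))"
  by (induction I rule: infinite_finite_induct) (simp_all add: lin_extend_add)

lemma lin_extend_lin_extend:
  "lin_extend g (lin_extend f c) = lin_extend (\<lambda>b. lin_extend g (f b)) c"
  by (simp add: lin_extend_def [of f] lin_extend_def [of _ c] lin_extend_sum lin_extend_lin_scale)

lemma lin_extend_diff_fun:
  "lin_extend (\<lambda>b. f b - g b) c = lin_extend f c - lin_extend g c"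
  by (rule poly_mapping_eqI)
     (simp add: lookup_lin_extend lookup_minus right_diff_distrib sum_subtractf)

lemma lin_extend_basis: "lin_extend (\<lambda>b. Poly_Mapping.single b 1) c = c"
proof (rule poly_mapping_eqI)
  fix y
  have "Poly_Mapping.lookup (lin_extend (\<lambda>b. Poly_Mapping.single b 1) c) y =
      (\<Sum>b\<in>insert y (Poly_Mapping.keys c). if b = y then Poly_Mapping.lookup c b else 0)"
    by (subst lookup_lin_extend_superset [of "insert y (Poly_Mapping.keys c)"], simp, blast,
        intro sum.cong refl) (simp add: lookup_single)
  thus "Poly_Mapping.lookup (lin_extend (\<lambda>b. Poly_Mapping.single b 1) c) y = Poly_Mapping.lookup c y"
    by (simp only: sum.delta finite_insert finite_keys) simp
qed

lemma keys_lin_extend: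
  assumes "\<And>b. b \<in> Poly_Mapping.keys c \<Longrightarrow> Poly_Mapping.keys (f b) \<subseteq> B"
  shows "Poly_Mapping.keys (lin_extend f c) \<subseteq> B"
proof
  fix y assume "y \<in> Poly_Mapping.keys (lin_extend f c)"
  hence "(\<Sum>b\<in>Poly_Mapping.keys c. Poly_Mapping.lookup c b * Poly_Mapping.lookup (f b) y) \<noteq> 0"
    by (simp add: in_keys_iff lookup_lin_extend)
  then obtain b where b: "b \<in> Poly_Mapping.keys c" "Poly_Mapping.lookup (f b) y \<noteq> 0"
    by (rule sum.not_neutral_contains_not_neutral) auto
  thus "y \<in> B" using assms [OF b(1)] by (auto simp: in_keys_iff)
qed

text \<open>
  The linear functional with prescribed values on the basis. It is used with integral coefficients
  and with coefficients in the field.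
\<close>

definition weight :: "('b \<Rightarrow> 'r) \<Rightarrow> ('b \<Rightarrow>\<^sub>0 'r::comm_ring_1) \<Rightarrow> 'r"
  where "weight m c = (\<Sum>b\<in>Poly_Mapping.keys c. Poly_Mapping.lookup c b * m b)"

lemma weight_superset:
  assumes "finite B" "Poly_Mapping.keys c \<subseteq> B"
  shows "weight m c = (\<Sum>b\<in>B. Poly_Mapping.lookup c b * m b)"
  unfolding weight_def using assms by (intro sum.mono_neutral_left) (auto simp: in_keys_iff)

lemma weight_add: "weight m (c + d) = weight m c + weight m d"
  using keys_add [of c d]
  by (simp add: weight_superset [of "Poly_Mapping.keys c \<union> Poly_Mapping.keys d"]
      lookup_add sum.distrib algebra_simps)

lemma weight_diff: "weight m (c - d) = weight m c - weight m d"
  using keys_diff [of c d]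
  by (simp add: weight_superset [of "Poly_Mapping.keys c \<union> Poly_Mapping.keys d"]
      lookup_minus sum_subtractf algebra_simps)

lemma weight_lin_scale: "weight m (lin_scale a c) = a * weight m c"
  using keys_lin_scale [of a c]
  by (simp add: weight_superset [of "Poly_Mapping.keys c"] sum_distrib_left mult.assoc)

lemma weight_0_fun: "weight (\<lambda>b. 0) c = 0"
  by (simp add: weight_def)

lemma weight_single: "weight m (Poly_Mapping.single b a) = a * m b"
  by (simp add: weight_superset [of "{b}"])

lemma weight_sum: "weight m (\<Sum>i\<in>I. c i) = (\<Sum>i\<in>I. weight m (c i))"
  by (induction I rule: infinite_finite_induct) (simp_all add: weight_add, simp_all add: weight_def)

lemma weight_lin_extend: "weight m (lin_extend f c) = weight (\<lambda>b. weight m (f b)) c"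
  by (simp add: lin_extend_def weight_sum weight_lin_scale) (simp add: weight_def)

lemma lin_extend_multiples:
  "lin_extend (\<lambda>b. lin_scale (m b) z) c = lin_scale (weight m c) z"
  by (rule poly_mapping_eqI)
     (simp add: lookup_lin_extend weight_def sum_distrib_right mult.assoc)


section \<open>Homology detected by a linear functional\<close>

definition cycle_space :: "'b set \<Rightarrow> ('b \<Rightarrow> ('b \<Rightarrow>\<^sub>0 'k::field)) \<Rightarrow> ('b \<Rightarrow>\<^sub>0 'k) set"
  where "cycle_space B g = {c. Poly_Mapping.keys c \<subseteq> B \<and> lin_extend g c = 0}"

definition boundary_space :: "'b set \<Rightarrow> ('b \<Rightarrow> ('b \<Rightarrow>\<^sub>0 'k::field)) \<Rightarrow> ('b \<Rightarrow>\<^sub>0 'k) set"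
  where "boundary_space A f = lin_extend f ` {c. Poly_Mapping.keys c \<subseteq> A}"

lemma cycle_space_add: "c \<in> cycle_space B g \<Longrightarrow> d \<in> cycle_space B g \<Longrightarrow> c + d \<in> cycle_space B g"
  using keys_add [of c d] by (auto simp: cycle_space_def lin_extend_add)

lemma cycle_space_scale: "c \<in> cycle_space B g \<Longrightarrow> lin_scale a c \<in> cycle_space B g"
  using keys_lin_scale [of a c] by (auto simp: cycle_space_def lin_extend_lin_scale)

lemma cycle_space_diff: "c \<in> cycle_space B g \<Longrightarrow> d \<in> cycle_space B g \<Longrightarrow> c - d \<in> cycle_space B g"
  using keys_diff [of c d] by (auto simp: cycle_space_def lin_extend_diff)

lemma cycle_space_0: "0 \<in> cycle_space B g"
  by (simp add: cycle_space_def)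

lemma boundary_space_0: "0 \<in> boundary_space A f"
  by (auto simp: boundary_space_def intro!: image_eqI [of _ _ 0])

text \<open>
  Such a functional identifies the homology with its range \<open>I\<close>, which is \<open>0\<close> or the whole field.
\<close>

definition homology_functional ::
  "'b set \<Rightarrow> ('b \<Rightarrow> ('b \<Rightarrow>\<^sub>0 'k::field)) \<Rightarrow> 'b set \<Rightarrow> ('b \<Rightarrow> ('b \<Rightarrow>\<^sub>0 'k)) \<Rightarrow>
    (('b \<Rightarrow>\<^sub>0 'k) \<Rightarrow> 'k) \<Rightarrow> 'k set \<Rightarrow> bool"
  where "homology_functional A f B g \<psi> I \<longleftrightarrow>
    boundary_space A f \<subseteq> cycle_space B g \<and>
    (\<forall>c\<in>cycle_space B g. \<forall>d\<in>cycle_space B g. \<psi> (c + d) = \<psi> c + \<psi> d) \<and>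
    (\<forall>a. \<forall>c\<in>cycle_space B g. \<psi> (lin_scale a c) = a * \<psi> c) \<and>
    (\<forall>c\<in>cycle_space B g. \<psi> c = 0 \<longleftrightarrow> c \<in> boundary_space A f) \<and>
    \<psi> ` cycle_space B g = I"

text \<open>
  The cosets of the boundaries are the fibres of the functional, so that the operations on cosets
  become those on values.
\<close>

lemma homology_space_fibres:
  fixes A :: "'b set" and \<psi> :: "('b \<Rightarrow>\<^sub>0 'k::field) \<Rightarrow> 'k"
  assumes \<psi>: "homology_functional A f B g \<psi> I"
  defines "M \<equiv> homology_space A f B g"
  defines "fib \<equiv> \<lambda>a. {c \<in> cycle_space B g. \<psi> c = a}"
  shows "carrier M = fib ` I" "inj_on fib I"
    and "a \<in> I \<Longrightarrow> b \<in> I \<Longrightarrow> fib a \<oplus>\<^bsub>M\<^esub> fib b = fib (a + b)"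
    and "a \<in> I \<Longrightarrow> t \<odot>\<^bsub>M\<^esub> fib a = fib (t * a)"
proof -
  let ?Z = "cycle_space B g" and ?B = "boundary_space A f"
  have BZ: "?B \<subseteq> ?Z"
    and add: "\<And>c d. c \<in> ?Z \<Longrightarrow> d \<in> ?Z \<Longrightarrow> \<psi> (c + d) = \<psi> c + \<psi> d"
    and scale: "\<And>t c. c \<in> ?Z \<Longrightarrow> \<psi> (lin_scale t c) = t * \<psi> c"
    and ker: "\<And>c. c \<in> ?Z \<Longrightarrow> \<psi> c = 0 \<longleftrightarrow> c \<in> ?B"
    and I: "\<psi> ` ?Z = I"
    using \<psi> unfolding homology_functional_def by blast+
  have diff: "\<psi> (d - c) = \<psi> d - \<psi> c" if "c \<in> ?Z" "d \<in> ?Z" for c d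
    using add [of c "d - c"] cycle_space_diff [of d B g c] that by (simp add: algebra_simps)
  have coset: "{c + b |b. b \<in> ?B} = fib (\<psi> c)" if c: "c \<in> ?Z" for c
  proof (intro Set.set_eqI iffI)
    fix d assume "d \<in> {c + b |b. b \<in> ?B}"
    then obtain b where b: "d = c + b" "b \<in> ?B" by blast
    moreover have "\<psi> b = 0" using b BZ ker by blast
    ultimately show "d \<in> fib (\<psi> c)"
      using add [of c b] c BZ cycle_space_add [of c B g b] by (auto simp: fib_def)
  next
    fix d assume d: "d \<in> fib (\<psi> c)"
    hence "d - c \<in> ?B"
      using ker [of "d - c"] diff [of c d] c cycle_space_diff [of d B g c] by (simp add: fib_def)
    moreover have "d = c + (d - c)" by simp
    ultimately show "d \<in> {c + b |b. b \<in> ?B}" by blast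
  qed
  have M: "M = \<lparr>carrier = (\<lambda>z. {z + b |b. b \<in> ?B}) ` ?Z, mult = undefined, one = undefined,
      zero = ?B, add = (\<lambda>X Y. {x + y |x y. x \<in> X \<and> y \<in> Y}),
      smult = (\<lambda>a X. {lin_scale a x + b |x b. x \<in> X \<and> b \<in> ?B})\<rparr>"
    by (simp add: M_def homology_space_def Let_def cycle_space_def boundary_space_def)
  have "carrier M = (\<lambda>z. fib (\<psi> z)) ` ?Z"
    unfolding M by (simp add: coset cong: image_cong)
  thus "carrier M = fib ` I" by (simp add: I [symmetric] image_image)
  show "inj_on fib I"
  proof (rule inj_onI)
    fix a b assume "a \<in> I" and eq: "fib a = fib b"
    then obtain c where c: "c \<in> ?Z" "\<psi> c = a" using I by blast
    hence "c \<in> fib a" by (simp add: fib_def)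
    hence "c \<in> fib b" by (simp only: eq)
    thus "a = b" using c by (simp add: fib_def)
  qed
  show "fib a \<oplus>\<^bsub>M\<^esub> fib b = fib (a + b)" if a: "a \<in> I" and b: "b \<in> I"
  proof -
    obtain c where c: "c \<in> ?Z" "\<psi> c = a" using I a by blast
    have "{x + y |x y. x \<in> fib a \<and> y \<in> fib b} = fib (a + b)"
    proof (intro Set.set_eqI iffI)
      fix z assume "z \<in> {x + y |x y. x \<in> fib a \<and> y \<in> fib b}"
      thus "z \<in> fib (a + b)" by (auto simp: fib_def add cycle_space_add)
    next
      fix z assume z: "z \<in> fib (a + b)"
      hence "z - c \<in> fib b" using c diff [of c z] by (simp add: fib_def cycle_space_diff)
      moreover have "c \<in> fib a" using c by (simp add: fib_def)
      moreover have "z = c + (z - c)" by simp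
      ultimately show "z \<in> {x + y |x y. x \<in> fib a \<and> y \<in> fib b}" by blast
    qed
    thus ?thesis by (simp add: M)
  qed
  show "t \<odot>\<^bsub>M\<^esub> fib a = fib (t * a)" if a: "a \<in> I"
  proof -
    obtain c where c: "c \<in> ?Z" "\<psi> c = a" using I a by blast
    have t: "lin_scale t c \<in> ?Z" "\<psi> (lin_scale t c) = t * a"
      using c scale cycle_space_scale by auto
    have "{lin_scale t x + b |x b. x \<in> fib a \<and> b \<in> ?B} = fib (t * a)"
    proof (intro Set.set_eqI iffI)
      fix z assume "z \<in> {lin_scale t x + b |x b. x \<in> fib a \<and> b \<in> ?B}"
      then obtain x b where "z = lin_scale t x + b" "x \<in> fib a" "b \<in> ?B" by blast
      moreover from this have "b \<in> ?Z" "\<psi> b = 0" using BZ ker by blast+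
      ultimately show "z \<in> fib (t * a)" by (simp add: fib_def add scale cycle_space_add cycle_space_scale)
    next
      fix z assume "z \<in> fib (t * a)"
      hence "z \<in> {lin_scale t c + b |b. b \<in> ?B}" using coset [OF t(1)] t(2) by simp
      moreover have "c \<in> fib a" using c by (simp add: fib_def)
      ultimately show "z \<in> {lin_scale t x + b |x b. x \<in> fib a \<and> b \<in> ?B}" by blast
    qed
    thus ?thesis by (simp add: M)
  qed
qed

text \<open>
  The isomorphism matches the two fibres over each value.
\<close>

lemma lin_isomorphic_if_same_range:
  fixes \<psi> :: "('b \<Rightarrow>\<^sub>0 'k::field) \<Rightarrow> 'k" and \<phi> :: "('c \<Rightarrow>\<^sub>0 'k) \<Rightarrow> 'k"
  assumes \<psi>: "homology_functional A f B g \<psi> I"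
    and \<phi>: "homology_functional A' f' B' g' \<phi> I"
  shows "lin_isomorphic (homology_space A f B g) (homology_space A' f' B' g')"
proof -
  define M where "M = homology_space A f B g"
  define N where "N = homology_space A' f' B' g'"
  define F where "F a = {c \<in> cycle_space B g. \<psi> c = a}" for a
  define G where "G a = {c \<in> cycle_space B' g'. \<phi> c = a}" for a
  define h where "h = G \<circ> the_inv_into I F"
  note F = homology_space_fibres [OF \<psi>, folded M_def F_def]
  note G = homology_space_fibres [OF \<phi>, folded N_def G_def]
  have hF: "h (F a) = G a" if "a \<in> I" for a
    using that F(2) by (simp add: h_def the_inv_into_f_f)
  have I: "\<psi> ` cycle_space B g = I"
    and add: "\<And>c d. c \<in> cycle_space B g \<Longrightarrow> d \<in> cycle_space B g \<Longrightarrow> \<psi> (c + d) = \<psi> c + \<psi> d"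
    and scale: "\<And>t c. c \<in> cycle_space B g \<Longrightarrow> \<psi> (lin_scale t c) = t * \<psi> c"
    using \<psi> by (simp_all add: homology_functional_def)
  have I_add: "a + b \<in> I" if ab: "a \<in> I" "b \<in> I" for a b
  proof -
    obtain c d where cd: "c \<in> cycle_space B g" "\<psi> c = a" "d \<in> cycle_space B g" "\<psi> d = b"
      using ab I by blast
    show ?thesis using add [OF cd(1,3)] cycle_space_add [OF cd(1,3)] cd(2,4) I by (metis image_eqI)
  qed
  have I_scale: "t * a \<in> I" if a: "a \<in> I" for t a
  proof -
    obtain c where c: "c \<in> cycle_space B g" "\<psi> c = a" using a I by blast
    show ?thesis using scale [OF c(1), of t] cycle_space_scale [OF c(1), of t] c(2) I by (metis image_eqI)
  qed
  have "bij_betw h (carrier M) (carrier N)"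
    unfolding F(1) G(1) h_def
    by (intro bij_betw_trans [of _ _ I] bij_betw_the_inv_into)
       (use F(2) G(2) in \<open>auto simp: bij_betw_def\<close>)
  moreover have "\<forall>x\<in>carrier M. \<forall>y\<in>carrier M. h (x \<oplus>\<^bsub>M\<^esub> y) = h x \<oplus>\<^bsub>N\<^esub> h y"
    unfolding F(1) by (auto simp: F(3) G(3) hF I_add)
  moreover have "\<forall>t. \<forall>x\<in>carrier M. h (t \<odot>\<^bsub>M\<^esub> x) = t \<odot>\<^bsub>N\<^esub> h x"
    unfolding F(1) by (auto simp: F(4) G(4) hF I_scale)
  ultimately show ?thesis
    unfolding lin_isomorphic_def M_def [symmetric] N_def [symmetric] by blast
qed

text \<open>
  A functional that is found by making choices is given first as a relation. The relation is
  single-valued: the difference of two values at the same cycle is a value at \<open>0\<close>, which is a boundary.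
\<close>

lemma homology_functional_of_relation:
  fixes R :: "('b \<Rightarrow>\<^sub>0 'k::field) \<Rightarrow> 'k \<Rightarrow> bool"
  assumes BZ: "boundary_space A f \<subseteq> cycle_space B g"
    and total: "\<And>c. c \<in> cycle_space B g \<Longrightarrow> \<exists>a. R c a"
    and add: "\<And>c d a b. R c a \<Longrightarrow> R d b \<Longrightarrow> R (c + d) (a + b)"
    and scale: "\<And>c a t. R c a \<Longrightarrow> R (lin_scale t c) (t * a)"
    and ker: "\<And>c a. R c a \<Longrightarrow> a = 0 \<longleftrightarrow> c \<in> boundary_space A f"
    and I: "\<And>a. a \<in> I \<longleftrightarrow> (\<exists>c\<in>cycle_space B g. R c a)"
  shows "\<exists>\<psi>. homology_functional A f B g \<psi> I"
proof -
  define \<psi> where "\<psi> c = (SOME a. R c a)" for c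
  have unique: "a = b" if "R c a" "R c b" for c a b
  proof -
    have "R (c + lin_scale (- 1) c) (a + - 1 * b)" using that by (intro add scale)
    moreover have "c + lin_scale (- 1) c = 0" by (simp flip: uminus_eq_lin_scale)
    ultimately show ?thesis using ker [of 0 "a + - 1 * b"] boundary_space_0 by simp
  qed
  have \<psi>: "\<psi> c = a" if "R c a" for c a
    unfolding \<psi>_def using that unique by blast
  have R: "R c (\<psi> c)" if "c \<in> cycle_space B g" for c
    using total [OF that] \<psi> by blast
  have "\<psi> ` cycle_space B g = I"
  proof (intro Set.set_eqI iffI)
    fix a assume "a \<in> \<psi> ` cycle_space B g"
    thus "a \<in> I" using I R by blast
  next
    fix a assume "a \<in> I"
    then obtain c where "c \<in> cycle_space B g" "R c a" using I by blast
    thus "a \<in> \<psi> ` cycle_space B g" using \<psi> by blast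
  qed
  moreover have "\<psi> (c + d) = \<psi> c + \<psi> d" if "c \<in> cycle_space B g" "d \<in> cycle_space B g" for c d
    by (intro \<psi> add R that)
  moreover have "\<psi> (lin_scale t c) = t * \<psi> c" if "c \<in> cycle_space B g" for t c
    by (intro \<psi> scale R that)
  ultimately have "homology_functional A f B g \<psi> I"
    unfolding homology_functional_def using BZ ker [OF R] by blast
  thus ?thesis by blast
qed


section \<open>From integral to field coefficients\<close>

definition field_chain :: "('b \<Rightarrow>\<^sub>0 int) \<Rightarrow> ('b \<Rightarrow>\<^sub>0 'k::field)"
  where "field_chain c = Poly_Mapping.map of_int c"

lemma lookup_field_chain [simp]:
  "Poly_Mapping.lookup (field_chain c) b = of_int (Poly_Mapping.lookup c b)"
  by (simp add: field_chain_def Poly_Mapping.map.rep_eq when_def)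

lemma field_chain_0 [simp]: "field_chain 0 = 0"
  by (simp add: poly_mapping_eqI)

lemma keys_field_chain: "Poly_Mapping.keys (field_chain c) \<subseteq> Poly_Mapping.keys c"
  by (auto simp: in_keys_iff)

lemma field_chain_diff: "field_chain (c - d) = field_chain c - field_chain d"
  by (rule poly_mapping_eqI) (simp add: lookup_minus)

lemma field_chain_cmul: "field_chain (frag_cmul a c) = lin_scale (of_int a) (field_chain c)"
  by (rule poly_mapping_eqI) simp

lemma field_chain_sum: "field_chain (\<Sum>i\<in>I. c i) = (\<Sum>i\<in>I. field_chain (c i))"
  by (rule poly_mapping_eqI) (simp add: lookup_sum)

lemma field_chain_of: "field_chain (frag_of b) = Poly_Mapping.single b 1"
  by (rule poly_mapping_eqI) (simp add: lookup_single when_def)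

lemma field_chain_extend:
  "field_chain (frag_extend f c) = lin_extend (\<lambda>b. field_chain (f b)) (field_chain c)"
proof (rule poly_mapping_eqI)
  fix y
  show "Poly_Mapping.lookup (field_chain (frag_extend f c)) y =
      Poly_Mapping.lookup (lin_extend (\<lambda>b. field_chain (f b)) (field_chain c)) y"
    by (simp add: frag_extend_def lookup_sum
        lookup_lin_extend_superset [OF finite_keys keys_field_chain])
qed

lemma weight_field_chain: "weight (\<lambda>b. of_int (m b)) (field_chain c) = of_int (weight m c)"
  by (simp add: weight_superset [OF finite_keys keys_field_chain]) (simp add: weight_def)

lemma field_chain_boundary:
  assumes "p \<ge> 1"
  shows "field_chain (chain_boundary p c) =
    (lin_extend (singular_bd (int p)) (field_chain c) :: _ \<Rightarrow>\<^sub>0 'k::field)"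
proof -
  have "field_chain (\<Sum>k\<le>p. frag_cmul ((-1) ^ k) (frag_of (singular_face p k \<sigma>))) =
      (singular_bd (int p) \<sigma> :: _ \<Rightarrow>\<^sub>0 'k)"
    for \<sigma> :: "(nat \<Rightarrow> real) \<Rightarrow> 'a"
  proof -
    have "lin_scale (of_int ((-1) ^ k)) (Poly_Mapping.single \<tau> 1) =
        Poly_Mapping.single \<tau> ((-1) ^ k :: 'k)"
      for k and \<tau> :: "(nat \<Rightarrow> real) \<Rightarrow> 'a"
      by (rule poly_mapping_eqI) (simp add: lookup_single when_def)
    thus ?thesis
      using assms by (simp add: singular_bd_def field_chain_sum field_chain_cmul field_chain_of)
  qed
  thus ?thesis using assms by (simp add: chain_boundary_def field_chain_extend)
qed


section \<open>Contracting the singular complex of an integral homology sphere\<close>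

text \<open>
  Vanishing homology is the case \<open>z = 0\<close>, and infinite cyclic homology the case \<open>z \<noteq> 0\<close>. The last
  condition excludes torsion in the form that covers both: a multiple of \<open>z\<close> that bounds is zero
  already as a chain.
\<close>

definition free_homology_generator :: "nat \<Rightarrow> 'a topology \<Rightarrow> 'a chain \<Rightarrow> bool"
  where "free_homology_generator p X z \<longleftrightarrow>
    singular_relcycle p X {} z \<and>
    (\<forall>c. singular_relcycle p X {} c \<longrightarrow> (\<exists>k. singular_relboundary p X {} (c - frag_cmul k z))) \<and>
    (\<forall>k. singular_relboundary p X {} (frag_cmul k z) \<longrightarrow> frag_cmul k z = 0)"

lemma free_homology_generator_trivial:
  assumes "trivial_group (homology_group (int p) X)"
  shows "free_homology_generator p X 0"
proof -
  have "singular_relboundary p X {} c" if c: "singular_relcycle p X {} c" for c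
  proof -
    have "homologous_rel_set p X {} c \<in> carrier (homology_group (int p) X)"
      using c by (auto simp: carrier_relative_homology_group)
    hence "homologous_rel_set p X {} c = singular_relboundary_set p X {}"
      using assms by (simp add: trivial_group_def)
    thus ?thesis by (simp only: homologous_rel_set_eq_relboundary)
  qed
  thus ?thesis by (simp add: free_homology_generator_def)
qed

text \<open>
  The generator represents the class that is sent to \<open>1\<close>. Passing from the group to chains, the
  isomorphism becomes an additive map on cycles that vanishes exactly on the boundaries.
\<close>

lemma free_homology_generator_infinite_cyclic:
  assumes "homology_group (int p) X \<cong> integer_group"
  shows "\<exists>z. z \<noteq> 0 \<and> free_homology_generator p X z"
proof -
  let ?H = "homology_group (int p) X" and ?Z = "singular_relcycle_set p X {}"
  obtain \<phi> where \<phi>: "\<phi> \<in> iso ?H integer_group"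
    using assms by (auto simp: is_iso_def)
  define \<Phi> where "\<Phi> c = \<phi> (homologous_rel_set p X {} c)" for c
  have cls: "homologous_rel_set p X {} c \<in> carrier ?H" if "c \<in> ?Z" for c
    using that by (auto simp: carrier_relative_homology_group)
  have "homologous_rel_set p X {} \<in> hom (relcycle_group p X {}) ?H"
    using normal.r_coset_hom_Mod [OF normal_subgroup_singular_relboundary_relcycle [of p X "{}"]]
    by (simp add: right_coset_singular_relboundary nontrivial_relative_homology_group)
  hence "homologous_rel_set p X {} (c + d) =
      homologous_rel_set p X {} c \<otimes>\<^bsub>?H\<^esub> homologous_rel_set p X {} d" if "c \<in> ?Z" "d \<in> ?Z" for c d
    using that by (simp add: hom_def)
  moreover have "\<phi> (x \<otimes>\<^bsub>?H\<^esub> y) = \<phi> x + \<phi> y" if "x \<in> carrier ?H" "y \<in> carrier ?H" for x y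
    using \<phi> that by (simp add: iso_def hom_def)
  ultimately have add: "\<Phi> (c + d) = \<Phi> c + \<Phi> d" if "c \<in> ?Z" "d \<in> ?Z" for c d
    using that cls by (simp add: \<Phi>_def)
  have Z: "c - d \<in> ?Z" "frag_cmul k c \<in> ?Z" if "c \<in> ?Z" "d \<in> ?Z" for c d k
    using that singular_relcycle_diff singular_relcycle_cmul by auto
  have diff: "\<Phi> (c - d) = \<Phi> c - \<Phi> d" if "c \<in> ?Z" "d \<in> ?Z" for c d
    using add [OF Z(1) [OF that] that(2)] by simp
  have zero: "\<Phi> 0 = 0" using diff [of 0 0] by simp
  have boundary: "singular_relboundary p X {} c \<longleftrightarrow> \<Phi> c = 0" if c: "c \<in> ?Z" for c
  proof -
    have "inj_on \<phi> (carrier ?H)" using \<phi> by (simp add: iso_def bij_betw_def)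
    hence "\<Phi> c = \<Phi> 0 \<longleftrightarrow> homologous_rel_set p X {} c = homologous_rel_set p X {} 0"
      unfolding \<Phi>_def using cls [OF c] cls [of 0] by (simp add: inj_on_eq_iff)
    moreover have "homologous_rel_set p X {} 0 = singular_relboundary_set p X {}"
      unfolding homologous_rel_set_eq_relboundary by simp
    ultimately show ?thesis
      using homologous_rel_set_eq_relboundary [of p X "{}" c] zero by (simp only:)
  qed
  have "1 \<in> \<phi> ` carrier ?H" using \<phi> by (simp add: iso_def bij_betw_def)
  then obtain z where z: "z \<in> ?Z" "\<Phi> z = 1"
    by (auto simp: carrier_relative_homology_group \<Phi>_def)
  have mult: "\<Phi> (frag_cmul k z) = k" for k
  proof (induction k rule: int_induct [where k = 0])
    case base
    show ?case by (simp add: zero)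
  next
    case (step1 i)
    thus ?case using add [of "frag_cmul i z" z] z Z by (simp add: frag_cmul_distrib)
  next
    case (step2 i)
    thus ?case using diff [of "frag_cmul i z" z] z Z by (simp add: frag_cmul_diff_distrib)
  qed
  have "z \<noteq> 0" using z zero by auto
  moreover have "free_homology_generator p X z"
    unfolding free_homology_generator_def
  proof (intro conjI allI impI)
    show "singular_relcycle p X {} z" using z by simp
  next
    fix c assume c: "singular_relcycle p X {} c"
    have "\<Phi> (c - frag_cmul (\<Phi> c) z) = 0"
      using diff [of c "frag_cmul (\<Phi> c) z"] c z Z by (simp add: mult)
    thus "\<exists>k. singular_relboundary p X {} (c - frag_cmul k z)"
      using boundary c z Z by blast
  next
    fix k assume "singular_relboundary p X {} (frag_cmul k z)"
    hence "k = 0" using boundary [of "frag_cmul k z"] z Z by (simp add: mult)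
    thus "frag_cmul k z = 0" by simp
  qed
  ultimately show ?thesis by blast
qed

text \<open>
  This is what a choice in degree \<open>p\<close> has to satisfy for the choice in degree \<open>p + 1\<close> to be possible.
\<close>

definition fills_boundaries :: "nat \<Rightarrow> 'a topology \<Rightarrow> (((nat \<Rightarrow> real) \<Rightarrow> 'a) \<Rightarrow> 'a chain) \<Rightarrow> bool"
  where "fills_boundaries p X h \<longleftrightarrow>
    (\<forall>\<sigma>. singular_simplex p X \<sigma> \<longrightarrow> singular_chain (Suc p) X (h \<sigma>)) \<and>
    (\<forall>u. singular_chain (Suc p) X u \<longrightarrow>
      chain_boundary (Suc p) (frag_extend h (chain_boundary (Suc p) u)) = chain_boundary (Suc p) u)"

text \<open>
  The maps \<open>h\<close> from degree \<open>p - 1\<close> and \<open>h'\<close> from degree \<open>p\<close> form a chain homotopy in degree \<open>p\<close> between the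
  identity and the projection \<open>c \<mapsto> m(c)z\<close>.
\<close>

definition homotopy_off ::
  "nat \<Rightarrow> 'a topology \<Rightarrow> (((nat \<Rightarrow> real) \<Rightarrow> 'a) \<Rightarrow> 'a chain) \<Rightarrow> (((nat \<Rightarrow> real) \<Rightarrow> 'a) \<Rightarrow> 'a chain) \<Rightarrow>
    (((nat \<Rightarrow> real) \<Rightarrow> 'a) \<Rightarrow> int) \<Rightarrow> 'a chain \<Rightarrow> bool"
  where "homotopy_off p X h h' m z \<longleftrightarrow>
    (\<forall>\<sigma>. singular_simplex p X \<sigma> \<longrightarrow> singular_chain (Suc p) X (h' \<sigma>) \<and>
      chain_boundary (Suc p) (h' \<sigma>) =
        frag_of \<sigma> - frag_extend h (chain_boundary p (frag_of \<sigma>)) - frag_cmul (m \<sigma>) z)"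

lemma weight_frag_of: "weight m (frag_of b) = (m b :: int)"
  by (simp add: weight_single)

lemma homotopy_off_chain:
  assumes "homotopy_off p X h h' m z" "singular_chain p X c"
  shows "singular_chain (Suc p) X (frag_extend h' c)"
    and "chain_boundary (Suc p) (frag_extend h' c) =
      c - frag_extend h (chain_boundary p c) - frag_cmul (weight m c) z"
proof -
  show "singular_chain (Suc p) X (frag_extend h' c)"
    using assms by (intro singular_chain_extend) (auto simp: homotopy_off_def singular_chain_def)
  have c: "Poly_Mapping.keys c \<subseteq> singular_simplex_set p X"
    using assms(2) by (simp add: singular_chain_def)
  show "chain_boundary (Suc p) (frag_extend h' c) =
      c - frag_extend h (chain_boundary p c) - frag_cmul (weight m c) z"
    using c
  proof (induction c rule: frag_induction)
    case zero
    show ?case by (simp add: weight_def)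
  next
    case (one \<sigma>)
    thus ?case using assms(1) by (simp add: homotopy_off_def weight_frag_of)
  next
    case (diff a b)
    thus ?case
      by (simp add: frag_extend_diff chain_boundary_diff weight_diff frag_cmul_diff_distrib)
  qed
qed

text \<open>
  Since \<open>h\<close> fills the boundary of \<open>\<sigma>\<close>, the chain \<open>\<sigma> - h\<partial>\<sigma>\<close> is a cycle, and hence homologous to a
  multiple of \<open>z\<close>. Freeness of the chain group makes an independent choice for each \<open>\<sigma>\<close> possible. The
  coefficient is not determined when \<open>z = 0\<close>, and is set to \<open>0\<close> then, so that it gives the right functional.
\<close>

lemma homotopy_off_exists:
  assumes h: "fills_boundaries p X h" and z: "free_homology_generator (Suc p) X z"
  obtains h' m where "homotopy_off (Suc p) X h h' m z" "z = 0 \<longrightarrow> m = (\<lambda>_. 0)"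
proof -
  have "\<exists>k u. singular_chain (Suc (Suc p)) X u \<and> (z = 0 \<longrightarrow> k = 0) \<and>
      chain_boundary (Suc (Suc p)) u =
        frag_of \<sigma> - frag_extend h (chain_boundary (Suc p) (frag_of \<sigma>)) - frag_cmul k z"
    if \<sigma>: "singular_simplex (Suc p) X \<sigma>" for \<sigma>
  proof -
    let ?c = "frag_of \<sigma> - frag_extend h (chain_boundary (Suc p) (frag_of \<sigma>))"
    have ch: "singular_chain (Suc p) X (frag_of \<sigma>)" using \<sigma> by (simp add: singular_chain_of)
    have "singular_chain p X (chain_boundary (Suc p) (frag_of \<sigma>))"
      using ch by (rule singular_chain_boundary_alt)
    hence "singular_chain (Suc p) X (frag_extend h (chain_boundary (Suc p) (frag_of \<sigma>)))"
      using h by (intro singular_chain_extend) (auto simp: fills_boundaries_def singular_chain_def)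
    hence "singular_chain (Suc p) X ?c" using ch by (rule singular_chain_diff [rotated])
    moreover have "chain_boundary (Suc p) ?c = 0"
      using h ch by (simp add: chain_boundary_diff fills_boundaries_def)
    ultimately have "singular_relcycle (Suc p) X {} ?c" by (simp add: singular_cycle)
    then obtain k where k: "singular_relboundary (Suc p) X {} (?c - frag_cmul k z)"
      using z by (auto simp: free_homology_generator_def)
    have "singular_relboundary (Suc p) X {} (?c - frag_cmul (if z = 0 then 0 else k) z)"
      using k by (cases "z = 0") auto
    then obtain u where "singular_chain (Suc (Suc p)) X u"
      "chain_boundary (Suc (Suc p)) u = ?c - frag_cmul (if z = 0 then 0 else k) z"
      unfolding singular_boundary by blast
    thus ?thesis by (intro exI [of _ "if z = 0 then 0 else k"] exI [of _ u]) simp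
  qed
  then obtain m h' where mh: "\<And>\<sigma>. singular_simplex (Suc p) X \<sigma> \<Longrightarrow>
      singular_chain (Suc (Suc p)) X (h' \<sigma>) \<and> (z = 0 \<longrightarrow> m \<sigma> = 0) \<and>
      chain_boundary (Suc (Suc p)) (h' \<sigma>) =
        frag_of \<sigma> - frag_extend h (chain_boundary (Suc p) (frag_of \<sigma>)) - frag_cmul (m \<sigma>) z"
    by metis
  show ?thesis
  proof
    show "homotopy_off (Suc p) X h h' (if z = 0 then (\<lambda>_. 0) else m) z"
      using mh by (auto simp: homotopy_off_def)
  qed auto
qed

text \<open>
  For a boundary \<open>w\<close>, the chain \<open>h'w\<close> bounds \<open>w - m(w)z\<close>. Hence \<open>m(w)z\<close> bounds, which it can only do
  by being zero.
\<close>

lemma homotopy_off_boundary_weight: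
  assumes h: "homotopy_off (Suc p) X h h' m z" and z: "free_homology_generator (Suc p) X z"
    and u: "singular_chain (Suc (Suc p)) X u"
  shows "frag_cmul (weight m (chain_boundary (Suc (Suc p)) u)) z = 0"
proof -
  let ?w = "chain_boundary (Suc (Suc p)) u"
  have w: "singular_chain (Suc p) X ?w" using u by (rule singular_chain_boundary_alt)
  have "chain_boundary (Suc p) ?w = 0" using u by (rule chain_boundary_boundary_alt)
  hence "chain_boundary (Suc (Suc p)) (frag_extend h' ?w) = ?w - frag_cmul (weight m ?w) z"
    using homotopy_off_chain(2) [OF h w] by simp
  hence "chain_boundary (Suc (Suc p)) (u - frag_extend h' ?w) = frag_cmul (weight m ?w) z"
    by (simp add: chain_boundary_diff)
  moreover have "singular_chain (Suc (Suc p)) X (u - frag_extend h' ?w)"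
    using u homotopy_off_chain(1) [OF h w] by (rule singular_chain_diff)
  ultimately have "singular_relboundary (Suc p) X {} (frag_cmul (weight m ?w) z)"
    unfolding singular_boundary by blast
  thus ?thesis using z by (simp add: free_homology_generator_def)
qed

text \<open>
  The step of the induction on the degree: a homotopy in one degree prepares the choice in the next.
\<close>

lemma homotopy_off_fills_boundaries:
  assumes h: "homotopy_off (Suc p) X h h' m z" and z: "free_homology_generator (Suc p) X z"
  shows "fills_boundaries (Suc p) X h'"
  unfolding fills_boundaries_def
proof (intro conjI allI impI)
  fix \<sigma> assume "singular_simplex (Suc p) X \<sigma>"
  thus "singular_chain (Suc (Suc p)) X (h' \<sigma>)" using h by (simp add: homotopy_off_def)
next
  fix u assume u: "singular_chain (Suc (Suc p)) X u"
  show "chain_boundary (Suc (Suc p)) (frag_extend h' (chain_boundary (Suc (Suc p)) u)) =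
      chain_boundary (Suc (Suc p)) u"
    using homotopy_off_chain(2) [OF h singular_chain_boundary_alt [OF u]]
      chain_boundary_boundary_alt [OF u] homotopy_off_boundary_weight [OF h z u]
    by simp
qed

text \<open>
  Here \<open>h\<close> joins the base point \<open>\<sigma>\<^sub>0\<close> to every other point by a path.
\<close>

lemma cone_over_0_chain:
  assumes "\<And>\<sigma>. singular_simplex 0 X \<sigma> \<Longrightarrow> chain_boundary (Suc 0) (h \<sigma>) = frag_of \<sigma> - frag_of \<sigma>\<^sub>0"
    and "singular_chain 0 X c"
  shows "chain_boundary (Suc 0) (frag_extend h c) = c - frag_cmul (weight (\<lambda>_. 1) c) (frag_of \<sigma>\<^sub>0)"
proof -
  have "Poly_Mapping.keys c \<subseteq> singular_simplex_set 0 X"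
    using assms(2) by (simp add: singular_chain_def)
  thus ?thesis
  proof (induction c rule: frag_induction)
    case zero
    show ?case by (simp add: weight_def)
  next
    case (one \<sigma>)
    thus ?case using assms(1) by (simp add: weight_frag_of)
  next
    case (diff a b)
    thus ?case
      by (simp add: frag_extend_diff chain_boundary_diff weight_diff frag_cmul_diff_distrib)
  qed
qed

lemma augmentation_boundary:
  "weight (\<lambda>_. 1) (chain_boundary (Suc 0) u) = (0::int)"
proof -
  have "Poly_Mapping.keys u \<subseteq> UNIV" by simp
  thus ?thesis
  proof (induction u rule: frag_induction)
    case zero
    show ?case by (simp add: weight_def)
  next
    case (one \<sigma>)
    show ?case by (simp add: chain_boundary_of weight_diff weight_frag_of)
  next
    case (diff a b)
    thus ?case by (simp add: chain_boundary_diff weight_diff)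
  qed
qed

text \<open>
  The cone over a \<open>0\<close>-chain fills it up to a multiple of the base point, and this multiple is the sum
  of the coefficients, which is zero for a boundary.
\<close>

lemma fills_boundaries_0:
  assumes "\<And>\<sigma>. singular_simplex 0 X \<sigma> \<Longrightarrow>
      singular_chain (Suc 0) X (h \<sigma>) \<and> chain_boundary (Suc 0) (h \<sigma>) = frag_of \<sigma> - frag_of \<sigma>\<^sub>0"
  shows "fills_boundaries 0 X h"
  unfolding fills_boundaries_def
  using assms cone_over_0_chain [of X h \<sigma>\<^sub>0] singular_chain_boundary_alt [of 0 X]
  by (simp add: augmentation_boundary)

lemma fills_boundaries_exists:
  assumes "fills_boundaries 0 X h\<^sub>0" and "\<And>p. \<exists>z. free_homology_generator (Suc p) X z"
  shows "\<exists>h. fills_boundaries p X h"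
proof (induction p)
  case 0
  show ?case using assms(1) by blast
next
  case (Suc p)
  then obtain h where h: "fills_boundaries p X h" by blast
  obtain z where z: "free_homology_generator (Suc p) X z" using assms(2) by blast
  obtain h' m where "homotopy_off (Suc p) X h h' m z" using homotopy_off_exists [OF h z] by metis
  thus ?case using homotopy_off_fills_boundaries z by blast
qed


section \<open>Reduced homology of spheres with field coefficients\<close>

lemma keys_singular_bd:
  assumes "\<sigma> \<in> singular_basis X (p + 1)"
  shows "Poly_Mapping.keys (singular_bd (p + 1) \<sigma> :: _ \<Rightarrow>\<^sub>0 'k::field) \<subseteq> singular_basis X p"
proof -
  consider "p \<ge> 0" | "p = -1" | "p < -1" by linarith
  thus ?thesis
  proof cases
    case 1
    define q where "q = nat p"
    have p: "p = int q" using 1 by (simp add: q_def)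
    have nat: "nat (1 + int q) = Suc q" "nat (int q + 1) = Suc q" by simp_all
    have \<sigma>: "singular_simplex (Suc q) X \<sigma>"
      using assms by (simp add: p singular_basis_def nat)
    have "Poly_Mapping.keys (singular_bd (p + 1) \<sigma> :: _ \<Rightarrow>\<^sub>0 'k)
        \<subseteq> (\<Union>k\<le>Suc q. {singular_face (Suc q) k \<sigma>})"
      unfolding singular_bd_def p nat
      by (auto simp: nat simp del: sum.atMost_Suc dest!: subsetD [OF keys_sum] split: if_splits)
    thus ?thesis
      using singular_simplex_singular_face [OF \<sigma>] by (auto simp: p singular_basis_def)
  qed (use assms in \<open>auto simp: singular_basis_def singular_bd_def\<close>)
qed

lemma singular_bd_bd:
  assumes "\<sigma> \<in> singular_basis X (p + 1)"
  shows "lin_extend (singular_bd p) (singular_bd (p + 1) \<sigma>) = (0 :: _ \<Rightarrow>\<^sub>0 'k::field)"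
proof -
  consider "p \<ge> 1" | "p = 0" | "p < 0" by linarith
  thus ?thesis
  proof cases
    case 1
    define q where "q = nat p"
    have p: "p = int q" "q \<ge> 1" using 1 by (simp_all add: q_def)
    have nat: "nat (int q + 1) = Suc q" by simp
    have "singular_chain (Suc q) X (frag_of \<sigma>)"
      using assms by (simp add: p singular_basis_def nat singular_chain_of)
    hence "chain_boundary q (chain_boundary (Suc q) (frag_of \<sigma>)) = 0"
      by (rule chain_boundary_boundary_alt)
    hence "field_chain (chain_boundary q (chain_boundary (Suc q) (frag_of \<sigma>))) = (0 :: _ \<Rightarrow>\<^sub>0 'k)"
      by (simp add: poly_mapping_eqI)
    moreover have "int (Suc q) = p + 1" by (simp add: p)
    ultimately show ?thesis
      using p by (simp add: field_chain_boundary field_chain_of lin_extend_single del: of_nat_Suc)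
  next
    case 2
    thus ?thesis
      by (simp add: singular_bd_def lin_extend_add lin_extend_single lin_extend_diff flip: single_add)
         (simp add: poly_mapping_eqI lookup_add)
  next
    case 3
    thus ?thesis by (simp add: singular_bd_def lin_extend_eq_0)
  qed
qed

lemma singular_boundaries_subset_cycles:
  "boundary_space (singular_basis X (p + 1)) (singular_bd (p + 1)) \<subseteq>
    cycle_space (singular_basis X p) (singular_bd p :: _ \<Rightarrow> _ \<Rightarrow>\<^sub>0 'k::field)"
proof
  fix c :: "_ \<Rightarrow>\<^sub>0 'k" assume "c \<in> boundary_space (singular_basis X (p + 1)) (singular_bd (p + 1))"
  then obtain u where u: "c = lin_extend (singular_bd (p + 1)) u"
      "Poly_Mapping.keys u \<subseteq> singular_basis X (p + 1)"
    by (auto simp: boundary_space_def)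
  have "Poly_Mapping.keys c \<subseteq> singular_basis X p"
    unfolding u(1) by (rule keys_lin_extend, rule keys_singular_bd) (use u in blast)
  moreover have "lin_extend (singular_bd p) c = 0"
    unfolding u(1) lin_extend_lin_extend by (rule lin_extend_eq_0, rule singular_bd_bd) (use u in blast)
  ultimately show "c \<in> cycle_space (singular_basis X p) (singular_bd p)"
    by (simp add: cycle_space_def)
qed

lemma homology_functional_weight:
  assumes "\<And>\<sigma>. \<sigma> \<in> singular_basis X (p + 1) \<Longrightarrow> weight m (singular_bd (p + 1) \<sigma>) = (0::'k::field)"
    and "\<And>c. c \<in> cycle_space (singular_basis X p) (singular_bd p) \<Longrightarrow> weight m c = 0 \<Longrightarrow>
      c \<in> boundary_space (singular_basis X (p + 1)) (singular_bd (p + 1))"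
    and "weight m ` cycle_space (singular_basis X p) (singular_bd p) = I"
  shows "homology_functional (singular_basis X (p + 1)) (singular_bd (p + 1))
    (singular_basis X p) (singular_bd p) (weight m) I"
proof -
  have "weight m c = 0" if "c \<in> boundary_space (singular_basis X (p + 1)) (singular_bd (p + 1))" for c
  proof -
    obtain u where u: "c = lin_extend (singular_bd (p + 1)) u"
        "Poly_Mapping.keys u \<subseteq> singular_basis X (p + 1)"
      using \<open>c \<in> _\<close> by (auto simp: boundary_space_def)
    show ?thesis unfolding u(1) weight_lin_extend weight_def [of "\<lambda>b. weight m (_ b)"]
      using u(2) assms(1) by (intro sum.neutral) auto
  qed
  thus ?thesis
    unfolding homology_functional_def
    using singular_boundaries_subset_cycles assms(2,3) by (auto simp: weight_add weight_lin_scale)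
qed

text \<open>
  The integral homotopy formula is an identity between values on simplices, so it holds over the field
  as well. It shows that a field cycle on which the functional vanishes is a boundary. Integral
  identities also give that the functional vanishes on boundaries and has the value \<open>1\<close> at \<open>z\<close>.
\<close>

lemma field_homology_positive:
  assumes h: "homotopy_off (Suc p) X h h' m z" and z: "free_homology_generator (Suc p) X z"
    and m0: "z = 0 \<longrightarrow> m = (\<lambda>_. 0)"
  shows "homology_functional (singular_basis X (int (Suc p) + 1)) (singular_bd (int (Suc p) + 1))
    (singular_basis X (int (Suc p))) (singular_bd (int (Suc p)))
    (weight (\<lambda>\<sigma>. of_int (m \<sigma>) :: 'k::field)) (if z = 0 then {0} else UNIV)"
proof (rule homology_functional_weight)
  let ?m = "\<lambda>\<sigma>. of_int (m \<sigma>) :: 'k"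
  let ?d = "singular_bd (int (Suc p)) :: _ \<Rightarrow> _ \<Rightarrow>\<^sub>0 'k"
  let ?d' = "singular_bd (int (Suc p) + 1) :: _ \<Rightarrow> _ \<Rightarrow>\<^sub>0 'k"
  have d': "field_chain (chain_boundary (Suc (Suc p)) c) = lin_extend ?d' (field_chain c)" for c :: "'a chain"
    by (subst field_chain_boundary) (simp_all add: add.commute)
  have d: "field_chain (chain_boundary (Suc p) c) = lin_extend ?d (field_chain c)" for c :: "'a chain"
    by (rule field_chain_boundary) simp
  have basis: "singular_basis X (int (Suc p)) = singular_simplex_set (Suc p) X"
      "singular_basis X (int (Suc p) + 1) = singular_simplex_set (Suc (Suc p)) X"
    by (simp_all add: singular_basis_def nat_add_distrib)
  have weight_boundary: "weight m (chain_boundary (Suc (Suc p)) u) = 0"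
    if "singular_chain (Suc (Suc p)) X u" for u
    using homotopy_off_boundary_weight [OF h z that] m0 by (auto simp: weight_0_fun)
  show "weight ?m (?d' \<sigma>) = 0" if "\<sigma> \<in> singular_basis X (int (Suc p) + 1)" for \<sigma>
  proof -
    have "singular_chain (Suc (Suc p)) X (frag_of \<sigma>)"
      using that unfolding basis by (simp add: singular_chain_of)
    hence "of_int (weight m (chain_boundary (Suc (Suc p)) (frag_of \<sigma>))) = (0::'k)"
      by (simp add: weight_boundary)
    thus ?thesis
      unfolding weight_field_chain [symmetric] d' by (simp add: field_chain_of lin_extend_single)
  qed
  show "c \<in> boundary_space (singular_basis X (int (Suc p) + 1)) ?d'"
    if c: "c \<in> cycle_space (singular_basis X (int (Suc p))) ?d" and "weight ?m c = 0" for c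
  proof -
    let ?u = "lin_extend (\<lambda>\<sigma>. field_chain (h' \<sigma>)) c"
    have keys: "\<sigma> \<in> Poly_Mapping.keys c \<Longrightarrow> singular_simplex (Suc p) X \<sigma>" for \<sigma>
      using c unfolding cycle_space_def basis by blast
    have "lin_extend ?d' ?u = lin_extend (\<lambda>\<sigma>. Poly_Mapping.single \<sigma> 1 -
        lin_extend (\<lambda>\<tau>. field_chain (h \<tau>)) (?d \<sigma>) - lin_scale (?m \<sigma>) (field_chain z)) c"
      unfolding lin_extend_lin_extend d' [symmetric]
    proof (rule lin_extend_cong)
      fix \<sigma> assume "\<sigma> \<in> Poly_Mapping.keys c"
      hence "chain_boundary (Suc (Suc p)) (h' \<sigma>) =
          frag_of \<sigma> - frag_extend h (chain_boundary (Suc p) (frag_of \<sigma>)) - frag_cmul (m \<sigma>) z"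
        using h keys by (simp add: homotopy_off_def)
      thus "field_chain (chain_boundary (Suc (Suc p)) (h' \<sigma>)) = Poly_Mapping.single \<sigma> 1 -
          lin_extend (\<lambda>\<tau>. field_chain (h \<tau>)) (?d \<sigma>) - lin_scale (?m \<sigma>) (field_chain z)"
        by (simp add: field_chain_diff field_chain_of field_chain_extend d field_chain_cmul lin_extend_single
             del: of_nat_Suc)
    qed
    also have "\<dots> = c - lin_extend (\<lambda>\<tau>. field_chain (h \<tau>)) (lin_extend ?d c) -
        lin_scale (weight ?m c) (field_chain z)"
      by (simp add: lin_extend_diff_fun lin_extend_basis lin_extend_multiples lin_extend_lin_extend)
    also have "\<dots> = c" using that by (simp add: cycle_space_def)
    finally have "c = lin_extend ?d' ?u" ..
    moreover have "Poly_Mapping.keys ?u \<subseteq> singular_basis X (int (Suc p) + 1)"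
    proof (rule keys_lin_extend)
      fix \<sigma> assume "\<sigma> \<in> Poly_Mapping.keys c"
      hence "singular_chain (Suc (Suc p)) X (h' \<sigma>)" using h keys by (simp add: homotopy_off_def)
      thus "Poly_Mapping.keys (field_chain (h' \<sigma>)) \<subseteq> singular_basis X (int (Suc p) + 1)"
        unfolding basis using keys_field_chain [of "h' \<sigma>"] by (auto simp: singular_chain_def)
    qed
    ultimately show ?thesis unfolding boundary_space_def by blast
  qed
  show "weight ?m ` cycle_space (singular_basis X (int (Suc p))) ?d = (if z = 0 then {0} else UNIV)"
  proof (cases "z = 0")
    case True
    hence "weight ?m c = 0" for c using m0 by (simp add: weight_0_fun)
    thus ?thesis using True cycle_space_0 by (auto intro!: image_eqI [of _ _ 0])
  next
    case False
    have zc: "singular_chain (Suc p) X z" "chain_boundary (Suc p) z = 0"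
      using z by (simp_all add: free_homology_generator_def singular_cycle)
    have "chain_boundary (Suc (Suc p)) (frag_extend h' z) = frag_cmul (1 - weight m z) z"
      using homotopy_off_chain(2) [OF h zc(1)] zc(2) by (simp add: frag_cmul_diff_distrib)
    hence "singular_relboundary (Suc p) X {} (frag_cmul (1 - weight m z) z)"
      unfolding singular_boundary using homotopy_off_chain(1) [OF h zc(1)] by blast
    hence "weight m z = 1" using z False by (auto simp: free_homology_generator_def)
    hence one: "weight ?m (field_chain z) = 1" by (simp add: weight_field_chain)
    have "Poly_Mapping.keys (field_chain z :: _ \<Rightarrow>\<^sub>0 'k) \<subseteq> singular_basis X (int (Suc p))"
      unfolding basis using zc(1) keys_field_chain [of z] by (auto simp: singular_chain_def)
    moreover have "lin_extend ?d (field_chain z) = 0"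
      unfolding d [symmetric] zc(2) by simp
    ultimately have "field_chain z \<in> cycle_space (singular_basis X (int (Suc p))) ?d"
      by (simp only: cycle_space_def mem_Collect_eq simp_thms)
    hence "a \<in> weight ?m ` cycle_space (singular_basis X (int (Suc p))) ?d" for a
      using one cycle_space_scale by (intro image_eqI [of _ _ "lin_scale a (field_chain z)"])
        (auto simp: weight_lin_scale)
    thus ?thesis using False by auto
  qed
qed

text \<open>
  In the augmented complex a cycle of degree \<open>0\<close> has coefficient sum \<open>0\<close>, and so it bounds the cone
  over it.
\<close>

lemma field_homology_zero:
  assumes h: "\<And>\<sigma>. singular_simplex 0 X \<sigma> \<Longrightarrow>
      singular_chain (Suc 0) X (h \<sigma>) \<and> chain_boundary (Suc 0) (h \<sigma>) = frag_of \<sigma> - frag_of \<sigma>\<^sub>0"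
  shows "homology_functional (singular_basis X (0 + 1)) (singular_bd (0 + 1))
    (singular_basis X 0) (singular_bd 0) (weight (\<lambda>_. 0 :: 'k::field)) {0}"
proof (rule homology_functional_weight)
  let ?d = "singular_bd 0 :: _ \<Rightarrow> _ \<Rightarrow>\<^sub>0 'k" and ?d' = "singular_bd (0 + 1) :: _ \<Rightarrow> _ \<Rightarrow>\<^sub>0 'k"
  have d': "field_chain (chain_boundary (Suc 0) c) = lin_extend ?d' (field_chain c)" for c :: "'a chain"
    using field_chain_boundary [of "Suc 0" c] by simp
  show "c \<in> boundary_space (singular_basis X (0 + 1)) ?d'"
    if c: "c \<in> cycle_space (singular_basis X 0) ?d" for c
  proof -
    let ?u = "lin_extend (\<lambda>\<sigma>. field_chain (h \<sigma>)) c"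
    have keys: "\<sigma> \<in> Poly_Mapping.keys c \<Longrightarrow> singular_simplex 0 X \<sigma>" for \<sigma>
      using c by (auto simp: cycle_space_def singular_basis_def)
    have "lin_extend ?d c = lin_extend (\<lambda>_. lin_scale 1 (Poly_Mapping.single (\<lambda>_. undefined) 1)) c"
      by (intro lin_extend_cong) (simp add: singular_bd_def)
    hence "lin_scale (weight (\<lambda>_. 1) c) (Poly_Mapping.single (\<lambda>_. undefined) 1) =
        (0 :: ((nat \<Rightarrow> real) \<Rightarrow> 'a) \<Rightarrow>\<^sub>0 'k)"
      using c unfolding lin_extend_multiples by (simp add: cycle_space_def)
    hence w: "weight (\<lambda>_. 1) c = 0"
      by (metis lookup_lin_scale lookup_single_eq lookup_zero mult.right_neutral)
    have "lin_extend ?d' ?u = lin_extend (\<lambda>\<sigma>. Poly_Mapping.single \<sigma> 1 -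
        lin_scale 1 (Poly_Mapping.single \<sigma>\<^sub>0 1)) c"
      unfolding lin_extend_lin_extend d' [symmetric]
      using h keys by (intro lin_extend_cong) (simp add: field_chain_diff field_chain_of)
    also have "\<dots> = c"
      unfolding lin_extend_diff_fun lin_extend_basis lin_extend_multiples by (simp add: w)
    finally have "c = lin_extend ?d' ?u" ..
    moreover have "Poly_Mapping.keys ?u \<subseteq> singular_basis X (0 + 1)"
    proof (rule keys_lin_extend)
      fix \<sigma> assume "\<sigma> \<in> Poly_Mapping.keys c"
      hence "singular_chain (Suc 0) X (h \<sigma>)" using h keys by blast
      thus "Poly_Mapping.keys (field_chain (h \<sigma>)) \<subseteq> singular_basis X (0 + 1)"
        using keys_field_chain [of "h \<sigma>"] by (auto simp: singular_chain_def singular_basis_def)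
    qed
    ultimately show ?thesis unfolding boundary_space_def by blast
  qed
  show "weight (\<lambda>_. 0) ` cycle_space (singular_basis X 0) ?d = {0}"
    using cycle_space_0 by (auto simp: weight_0_fun intro!: image_eqI [of _ _ 0])
qed (simp add: weight_0_fun)

text \<open>
  In degree \<open>-1\<close> the empty simplex is the boundary of a point.
\<close>

lemma field_homology_negative:
  assumes \<sigma>\<^sub>0: "singular_simplex 0 X \<sigma>\<^sub>0" and "p < 0"
  shows "homology_functional (singular_basis X (p + 1)) (singular_bd (p + 1))
    (singular_basis X p) (singular_bd p) (weight (\<lambda>_. 0 :: 'k::field)) {0}"
proof (rule homology_functional_weight)
  let ?d = "singular_bd p :: _ \<Rightarrow> _ \<Rightarrow>\<^sub>0 'k" and ?d' = "singular_bd (p + 1) :: _ \<Rightarrow> _ \<Rightarrow>\<^sub>0 'k"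
  show "c \<in> boundary_space (singular_basis X (p + 1)) ?d'"
    if c: "c \<in> cycle_space (singular_basis X p) ?d" for c
  proof (cases "p = -1")
    case True
    define u :: "((nat \<Rightarrow> real) \<Rightarrow> 'a) \<Rightarrow>\<^sub>0 'k"
      where "u = Poly_Mapping.single \<sigma>\<^sub>0 (Poly_Mapping.lookup c (\<lambda>_. undefined))"
    have "Poly_Mapping.keys c \<subseteq> {\<lambda>_. undefined}"
      using c True by (simp add: cycle_space_def singular_basis_def)
    hence "c = lin_extend ?d' u"
      using True by (intro poly_mapping_eqI)
        (auto simp: u_def lin_extend_single singular_bd_def lookup_single when_def in_keys_iff)
    moreover have "Poly_Mapping.keys u \<subseteq> singular_basis X (p + 1)"
      using \<sigma>\<^sub>0 True by (simp add: u_def singular_basis_def)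
    ultimately show ?thesis unfolding boundary_space_def by blast
  next
    case False
    hence "c = 0" using c \<open>p < 0\<close> by (simp add: cycle_space_def singular_basis_def)
    thus ?thesis by (simp add: boundary_space_0)
  qed
  show "weight (\<lambda>_. 0) ` cycle_space (singular_basis X p) ?d = {0}"
    using cycle_space_0 by (auto simp: weight_0_fun intro!: image_eqI [of _ _ 0])
qed (simp add: weight_0_fun)

text \<open>
  Both simplices have the same image in the one-point space, so that the class of their difference
  lies in the reduced homology group.
\<close>

lemma homologous_0_simplices:
  assumes triv: "trivial_group (reduced_homology_group 0 X)"
    and \<sigma>: "singular_simplex 0 X \<sigma>" and \<tau>: "singular_simplex 0 X \<tau>"
  shows "singular_relboundary 0 X {} (frag_of \<sigma> - frag_of \<tau>)"
proof -
  let ?c = "frag_of \<sigma> - frag_of \<tau>" and ?Y = "discrete_topology {()}"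
  have "singular_chain 0 X ?c" using \<sigma> \<tau> by (simp add: singular_chain_of singular_chain_diff)
  hence c: "singular_relcycle 0 X {} ?c" by (simp add: singular_cycle chain_boundary_def)
  have "simplex_map 0 (\<lambda>_. ()) \<sigma> = simplex_map 0 (\<lambda>_. ()) \<tau>"
    by (auto simp: simplex_map_def)
  hence "chain_map 0 (\<lambda>_. ()) ?c = 0" by (simp add: chain_map_diff)
  hence "hom_induced 0 X {} ?Y {} (\<lambda>_. ()) (homologous_rel_set 0 X {} ?c) = singular_relboundary_set 0 ?Y {}"
    using hom_induced_chain_map [of X ?Y "\<lambda>_. ()" "{}" "{}" 0 ?c] c
      homologous_rel_set_eq_relboundary [of 0 ?Y "{}" 0]
    by simp
  hence "homologous_rel_set 0 X {} ?c \<in> carrier (reduced_homology_group 0 X)"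
    unfolding carrier_reduced_homology_group kernel_def
    using c one_relative_homology_group [of 0 ?Y "{}"]
    by (auto simp: carrier_relative_homology_group_0)
  hence "homologous_rel_set 0 X {} ?c = singular_relboundary_set 0 X {}"
    using triv one_relative_homology_group [of 0 X "{}"]
    by (simp add: trivial_group_def one_reduced_homology_group)
  thus ?thesis by (simp only: homologous_rel_set_eq_relboundary)
qed

lemma field_homology_nsphere:
  assumes "n \<ge> 1"
  shows "\<exists>\<psi>. homology_functional (singular_basis (nsphere n) (p + 1)) (singular_bd (p + 1))
    (singular_basis (nsphere n) p) (singular_bd p) \<psi> (if p = int n then UNIV else {0 :: 'k::field})"
proof -
  let ?X = "nsphere n"
  obtain x where x: "x \<in> topspace ?X" using in_topspace_nsphere by blast
  define \<sigma>\<^sub>0 :: "(nat \<Rightarrow> real) \<Rightarrow> nat \<Rightarrow> real" where "\<sigma>\<^sub>0 = restrict (\<lambda>_. x) (standard_simplex 0)"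
  have \<sigma>\<^sub>0: "singular_simplex 0 ?X \<sigma>\<^sub>0"
    using x by (simp add: singular_simplex_def \<sigma>\<^sub>0_def)
  have "trivial_group (reduced_homology_group 0 ?X)"
    using assms reduced_homology_group_nsphere(2) [of 0 n] by simp
  hence "\<exists>u. singular_chain (Suc 0) ?X u \<and> chain_boundary (Suc 0) u = frag_of \<sigma> - frag_of \<sigma>\<^sub>0"
    if "singular_simplex 0 ?X \<sigma>" for \<sigma>
    using homologous_0_simplices [OF _ that \<sigma>\<^sub>0] unfolding singular_boundary by simp
  then obtain h\<^sub>0 where h\<^sub>0: "\<And>\<sigma>. singular_simplex 0 ?X \<sigma> \<Longrightarrow>
      singular_chain (Suc 0) ?X (h\<^sub>0 \<sigma>) \<and> chain_boundary (Suc 0) (h\<^sub>0 \<sigma>) = frag_of \<sigma> - frag_of \<sigma>\<^sub>0"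
    by metis
  have gen: "\<exists>z. free_homology_generator (Suc q) ?X z \<and> (z = 0 \<longleftrightarrow> Suc q \<noteq> n)" for q
  proof (cases "Suc q = n")
    case True
    hence "homology_group (int (Suc q)) ?X \<cong> integer_group"
      using reduced_homology_group_nsphere(1) [of n] un_reduced_homology_group [of "int n" ?X] assms by simp
    thus ?thesis using free_homology_generator_infinite_cyclic True by blast
  next
    case False
    hence "trivial_group (homology_group (int (Suc q)) ?X)"
      using reduced_homology_group_nsphere(2) [of "int (Suc q)" n]
        un_reduced_homology_group [of "int (Suc q)" ?X] by simp
    thus ?thesis using free_homology_generator_trivial False by blast
  qed
  consider q where "p = int (Suc q)" | "p = 0" | "p < 0"
    by (metis int_cases negative_zless not0_implies_Suc of_nat_0)
  thus ?thesis
  proof cases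
    case 1
    obtain h where h: "fills_boundaries q ?X h"
      using fills_boundaries_exists [OF fills_boundaries_0 [OF h\<^sub>0], of q] gen by blast
    obtain z where z: "free_homology_generator (Suc q) ?X z" "z = 0 \<longleftrightarrow> Suc q \<noteq> n" using gen by blast
    obtain h' m where hm: "homotopy_off (Suc q) ?X h h' m z" "z = 0 \<longrightarrow> m = (\<lambda>_. 0)"
      using homotopy_off_exists [OF h z(1)] .
    have "(if z = 0 then {0} else UNIV) = (if p = int n then UNIV else {0 :: 'k})"
      using z(2) 1 by auto
    thus ?thesis using field_homology_positive [OF hm(1) z(1) hm(2), where 'k = 'k] unfolding 1 by auto
  next
    case 2
    thus ?thesis using field_homology_zero [OF h\<^sub>0, where 'k = 'k] assms by auto
  next
    case 3
    thus ?thesis using field_homology_negative [OF \<sigma>\<^sub>0 3, where 'k = 'k] assms by auto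
  qed
qed


section \<open>The signed cube\<close>

definition bit_sign :: "bit \<Rightarrow> 'k::field"
  where "bit_sign b = (if b = 0 then 1 else - 1)"

lemma bit_sign_square [simp]: "bit_sign b * bit_sign b = 1"
  by (simp add: bit_sign_def)

lemma bit_sign_square_left [simp]: "bit_sign b * (bit_sign b * x) = x"
  by (simp add: bit_sign_def)

lemma bit_sign_swap:
  assumes "a + b = c + d + 1"
  shows "bit_sign a * bit_sign b = - (bit_sign c * bit_sign d)"
  using assms by (cases "a = 0"; cases "b = 0"; cases "c = 0"; cases "d = 0") (auto simp: bit_sign_def)

text \<open>
  The differential of the complex with a copy of the field at each subset of \<open>V\<close>, acting on chains
  written as functions of the subset.
\<close>

definition cube_diff :: "'a set \<Rightarrow> ('a set \<Rightarrow> 'a set \<Rightarrow> bit) \<Rightarrow> ('a set \<Rightarrow> 'k::field) \<Rightarrow> 'a set \<Rightarrow> 'k"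
  where "cube_diff V s F T = (\<Sum>S | colour_step V S T. bit_sign (s S T) * F S)"

text \<open>
  The chains of degree \<open>i\<close> on the face of the cube that consists of the subsets containing \<open>Q\<close>.
\<close>

definition supported :: "'a set \<Rightarrow> 'a set \<Rightarrow> int \<Rightarrow> ('a set \<Rightarrow> 'k::field) \<Rightarrow> bool"
  where "supported V Q i F \<longleftrightarrow> (\<forall>S. F S \<noteq> 0 \<longrightarrow> S \<subseteq> V \<and> Q \<subseteq> S \<and> int (card S) = i)"

lemma supportedD:
  assumes "supported V Q i F" "F S \<noteq> 0"
  shows "S \<subseteq> V" "Q \<subseteq> S" "int (card S) = i"
  using assms by (auto simp: supported_def)

lemma colour_steps_into:
  assumes "T \<subseteq> V"
  shows "{S. colour_step V S T} = (\<lambda>u. T - {u}) ` T"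
  using assms by (auto simp: colour_step_def image_iff)

lemma cube_diff_expand:
  assumes "T \<subseteq> V"
  shows "cube_diff V s F T = (\<Sum>u\<in>T. bit_sign (s (T - {u}) T) * F (T - {u}))"
proof -
  have "inj_on (\<lambda>u. T - {u}) T" by (auto simp: inj_on_def)
  thus ?thesis by (simp add: cube_diff_def colour_steps_into [OF assms] sum.reindex)
qed

lemma cube_diff_outside:
  assumes "\<not> T \<subseteq> V"
  shows "cube_diff V s F T = 0"
proof -
  have none: "{S. colour_step V S T} = {}" using assms by (auto simp: colour_step_def)
  show ?thesis unfolding cube_diff_def none by simp
qed

lemma cube_diff_0 [simp]: "cube_diff V s (\<lambda>_. 0) = (\<lambda>_. 0)"
  by (simp add: cube_diff_def fun_eq_iff)

lemma cube_diff_diff: "cube_diff V s (\<lambda>S. F S - G S) T = cube_diff V s F T - cube_diff V s G T"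
  by (simp add: cube_diff_def right_diff_distrib sum_subtractf)

lemma cube_diff_add: "cube_diff V s (\<lambda>S. F S + G S) T = cube_diff V s F T + cube_diff V s G T"
  by (simp add: cube_diff_def distrib_left sum.distrib)

lemma cube_diff_scale: "cube_diff V s (\<lambda>S. a * F S) T = a * cube_diff V s F T"
  by (simp add: cube_diff_def sum_distrib_left algebra_simps)

lemma supported_diff: "supported V Q i F \<Longrightarrow> supported V Q i G \<Longrightarrow> supported V Q i (\<lambda>S. F S - G S)"
  unfolding supported_def by (metis diff_0_right)

lemma supported_add: "supported V Q i F \<Longrightarrow> supported V Q i G \<Longrightarrow> supported V Q i (\<lambda>S. F S + G S)"
  unfolding supported_def by (metis add.left_neutral)

lemma supported_scale: "supported V Q i F \<Longrightarrow> supported V Q i (\<lambda>S. a * F S)"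
  unfolding supported_def by (metis mult_zero_right)

lemma supported_cube_diff:
  assumes "finite V" and F: "supported V Q i F"
  shows "supported V Q (i + 1) (cube_diff V s F)"
  unfolding supported_def
proof (intro allI impI)
  fix T assume "cube_diff V s F T \<noteq> 0"
  then obtain S where "S \<in> {S. colour_step V S T}" and S0: "bit_sign (s S T) * F S \<noteq> 0"
    unfolding cube_diff_def by (rule sum.not_neutral_contains_not_neutral)
  hence S: "colour_step V S T" by simp
  then obtain v where v: "v \<in> V - S" "T = insert v S" by (auto simp: colour_step_def)
  have "F S \<noteq> 0" using S0 by auto
  note D = supportedD [OF F this]
  have "finite S" using D(1) assms(1) finite_subset by blast
  thus "T \<subseteq> V \<and> Q \<subseteq> T \<and> int (card T) = i + 1" using D v by auto
qed

text \<open>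
  The terms have to be cancelled in pairs: that the sum equals its own negative would prove nothing in
  characteristic \<open>2\<close>.
\<close>

lemma sum_antisymmetric_eq_0:
  fixes g :: "'a::linorder \<Rightarrow> 'a \<Rightarrow> 'k::ab_group_add"
  assumes "finite A" and anti: "\<And>u w. u \<in> A \<Longrightarrow> w \<in> A \<Longrightarrow> u < w \<Longrightarrow> g w u = - g u w"
  shows "(\<Sum>u\<in>A. \<Sum>w\<in>A - {u}. g u w) = 0"
proof -
  have split: "(\<Sum>w\<in>A - {u}. g u w) = (\<Sum>w\<in>{w\<in>A. u < w}. g u w) + (\<Sum>w\<in>{w\<in>A. w < u}. g u w)" for u
  proof -
    have A: "A - {u} = {w\<in>A. u < w} \<union> {w\<in>A. w < u}"
      using linorder_neq_iff [of _ u] by blast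
    have "finite {w\<in>A. u < w}" "finite {w\<in>A. w < u}" using assms(1) by simp_all
    moreover have "{w\<in>A. u < w} \<inter> {w\<in>A. w < u} = {}" by (auto dest: less_asym)
    ultimately show ?thesis unfolding A by (rule sum.union_disjoint)
  qed
  have "(\<Sum>u\<in>A. \<Sum>w\<in>{w\<in>A. w < u}. g u w) = (\<Sum>w\<in>A. \<Sum>u\<in>{u\<in>A. w < u}. g u w)"
    using assms(1) by (intro sum.swap_restrict)
  also have "\<dots> = (\<Sum>w\<in>A. \<Sum>u\<in>{u\<in>A. w < u}. - g w u)"
    by (intro sum.cong refl) (simp add: anti)
  also have "\<dots> = - (\<Sum>u\<in>A. \<Sum>w\<in>{w\<in>A. u < w}. g u w)"
    by (simp add: sum_negf)
  finally show ?thesis by (simp add: split sum.distrib)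
qed

lemma cube_sign_swap:
  assumes s: "sign_assignment V s" and "insert u (insert w S) \<subseteq> V" "u \<notin> S" "w \<notin> S" "u \<noteq> w"
  shows "bit_sign (s S (insert u S)) * bit_sign (s (insert u S) (insert u (insert w S))) =
    - (bit_sign (s S (insert w S)) * bit_sign (s (insert w S) (insert u (insert w S))))"
proof (rule bit_sign_swap)
  have "colour_step V S (insert u S)" "colour_step V (insert u S) (insert u (insert w S))"
    "colour_step V S (insert w S)" "colour_step V (insert w S) (insert u (insert w S))"
    "insert u S \<noteq> insert w S"
    using assms(2-) by (auto simp: colour_step_def)
  thus "s S (insert u S) + s (insert u S) (insert u (insert w S)) =
      s S (insert w S) + s (insert w S) (insert u (insert w S)) + 1"
    using s unfolding sign_assignment_def by blast
qed

lemma cube_diff_cube_diff: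
  fixes V :: "'a::linorder set"
  assumes "finite V" and s: "sign_assignment V s"
  shows "cube_diff V s (cube_diff V s F) = (\<lambda>_. 0)"
proof
  fix T
  show "cube_diff V s (cube_diff V s F) T = 0"
  proof (cases "T \<subseteq> V")
    case True
    define g where "g u w = bit_sign (s (T - {u}) T) *
      (bit_sign (s (T - {u} - {w}) (T - {u})) * F (T - {u} - {w}))" for u w
    have "T - {u} \<subseteq> V" for u using True by blast
    hence "cube_diff V s (cube_diff V s F) T = (\<Sum>u\<in>T. \<Sum>w\<in>T - {u}. g u w)"
      by (simp add: cube_diff_expand True g_def sum_distrib_left)
    also have "\<dots> = 0"
    proof (rule sum_antisymmetric_eq_0)
      show "finite T" using True assms(1) finite_subset by blast
      show "g w u = - g u w" if "u \<in> T" "w \<in> T" "u < w" for u w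
      proof -
        define S where "S = T - {u} - {w}"
        have eqs: "T - {u} = insert w S" "T - {w} = insert u S"
            "T = insert u (insert w S)" "insert w S - {w} = S" "insert u S - {u} = S"
          using that by (auto simp: S_def)
        have "insert u (insert w S) \<subseteq> V" "u \<notin> S" "w \<notin> S" "u \<noteq> w"
          using True that by (auto simp: S_def)
        hence "bit_sign (s S (insert u S)) * bit_sign (s (insert u S) T) =
            - (bit_sign (s S (insert w S)) * bit_sign (s (insert w S) T) :: 'b)"
          unfolding eqs(3) by (rule cube_sign_swap [OF s])
        from arg_cong [OF this, of "\<lambda>x. x * F S"] show ?thesis
          unfolding g_def eqs(1,2,4,5) by (simp add: algebra_simps)
      qed
    qed
    finally show ?thesis .
  qed (rule cube_diff_outside)
qed

text \<open>
  Removing \<open>w\<close> from a subset is a contracting homotopy. It preserves the face of the subsets that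
  contain \<open>Q\<close>, because \<open>w\<close> is not in \<open>Q\<close>.
\<close>

lemma cube_exact:
  assumes "finite V" and s: "sign_assignment V s" and w: "w \<in> V" "w \<notin> Q"
    and F: "supported V Q i F" and closed: "cube_diff V s F = (\<lambda>_. 0)"
  shows "\<exists>M. supported V Q (i - 1) M \<and> cube_diff V s M = F"
proof -
  define M where "M S = (if S \<subseteq> V \<and> w \<notin> S then bit_sign (s S (insert w S)) * F (insert w S) else 0)" for S
  have "supported V Q (i - 1) M"
    unfolding supported_def
  proof (intro allI impI)
    fix S assume "M S \<noteq> 0"
    hence S: "S \<subseteq> V" "w \<notin> S" "F (insert w S) \<noteq> 0" by (auto simp: M_def split: if_splits)
    note D = supportedD [OF F S(3)]
    have "finite S" using S(1) assms(1) finite_subset by blast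
    thus "S \<subseteq> V \<and> Q \<subseteq> S \<and> int (card S) = i - 1" using D S w by auto
  qed
  moreover have "cube_diff V s M T = F T" for T
  proof (cases "T \<subseteq> V")
    case False
    thus ?thesis using F by (auto simp: cube_diff_outside supported_def)
  next
    case True
    have fin: "finite T" using True assms(1) finite_subset by blast
    show ?thesis
    proof (cases "w \<in> T")
      case True
      have "cube_diff V s M T = (\<Sum>u\<in>{w}. bit_sign (s (T - {u}) T) * M (T - {u}))"
        unfolding cube_diff_expand [OF \<open>T \<subseteq> V\<close>]
        using fin True by (intro sum.mono_neutral_right) (auto simp: M_def)
      also have "\<dots> = F T" using True \<open>T \<subseteq> V\<close> by (simp add: M_def insert_absorb subset_iff)
      finally show ?thesis .
    next
      case False
      let ?T = "insert w T" and ?e = "\<lambda>S T. bit_sign (s S T) :: 'b"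
      have sgn: "?e (T - {u}) T * ?e (T - {u}) (insert w (T - {u})) = - (?e T ?T * ?e (?T - {u}) ?T)"
        if u: "u \<in> T" for u
      proof -
        define S where "S = T - {u}"
        have eqs: "T = insert u S" "?T = insert u (insert w S)" "?T - {u} = insert w S"
          using u False by (auto simp: S_def)
        have "insert u (insert w S) \<subseteq> V" "u \<notin> S" "w \<notin> S" "u \<noteq> w"
          using \<open>T \<subseteq> V\<close> w u False by (auto simp: S_def)
        hence "?e S (insert u S) * ?e (insert u S) ?T = - (?e S (insert w S) * ?e (insert w S) ?T)"
          unfolding eqs(2) by (rule cube_sign_swap [OF s])
        hence "?e S T * ?e T ?T = - (?e S (insert w S) * ?e (insert w S) ?T)"
          by (simp only: eqs(1) [symmetric])
        hence "?e S T * ?e T ?T * (?e T ?T * ?e S (insert w S)) =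
            - (?e S (insert w S) * ?e (insert w S) ?T) * (?e T ?T * ?e S (insert w S))" by simp
        hence "?e S T * ?e S (insert w S) = - (?e T ?T * ?e (insert w S) ?T)"
          by (simp add: algebra_simps)
        thus ?thesis by (simp add: eqs(3) flip: S_def)
      qed
      have "?T \<subseteq> V" using \<open>T \<subseteq> V\<close> w by blast
      hence "0 = ?e T ?T * F T + (\<Sum>u\<in>T. ?e (?T - {u}) ?T * F (?T - {u}))"
        using fun_cong [OF closed, of ?T] fin False by (simp add: cube_diff_expand)
      hence sum: "(\<Sum>u\<in>T. ?e (?T - {u}) ?T * F (?T - {u})) = - (?e T ?T * F T)"
        by (simp add: eq_neg_iff_add_eq_0 add.commute)
      have "cube_diff V s M T = (\<Sum>u\<in>T. - ?e T ?T * (?e (?T - {u}) ?T * F (?T - {u})))"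
        unfolding cube_diff_expand [OF \<open>T \<subseteq> V\<close>]
      proof (intro sum.cong refl)
        fix u assume u: "u \<in> T"
        have "M (T - {u}) = ?e (T - {u}) (insert w (T - {u})) * F (insert w (T - {u}))"
          using \<open>T \<subseteq> V\<close> False by (auto simp: M_def)
        moreover have "insert w (T - {u}) = ?T - {u}" using u False by auto
        ultimately show "?e (T - {u}) T * M (T - {u}) = - ?e T ?T * (?e (?T - {u}) ?T * F (?T - {u}))"
          using sgn [OF u] by (simp add: mult.assoc [symmetric])
      qed
      also have "\<dots> = - ?e T ?T * - (?e T ?T * F T)"
        by (simp only: sum [symmetric] sum_distrib_left)
      also have "\<dots> = F T" by simp
      finally show ?thesis .
    qed
  qed
  ultimately show ?thesis by blast
qed


section \<open>Components of induced subgraphs\<close>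

lemma equiv_connected_within:
  assumes "sym E"
  shows "equiv S {(u, v) \<in> S \<times> S. (u, v) \<in> (E \<inter> S \<times> S)\<^sup>*}"
proof (rule equivI)
  have "sym (E \<inter> S \<times> S)" using assms by (auto simp: sym_def)
  hence "sym ((E \<inter> S \<times> S)\<^sup>*)" by (rule sym_rtrancl)
  thus "sym {(u, v) \<in> S \<times> S. (u, v) \<in> (E \<inter> S \<times> S)\<^sup>*}" by (auto simp: sym_def)
qed (auto simp: refl_on_def trans_def)

lemma component_subset: "x \<in> induced_components E S \<Longrightarrow> x \<subseteq> S"
  by (auto simp: induced_components_def quotient_def)

lemma component_nonempty: "x \<in> induced_components E S \<Longrightarrow> x \<noteq> {}"
  by (auto simp: induced_components_def quotient_def)

lemma components_disjoint:
  assumes "sym E" "x \<in> induced_components E S" "y \<in> induced_components E S" "x \<noteq> y"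
  shows "x \<inter> y = {}"
  using quotient_disj [OF equiv_connected_within [OF assms(1)]] assms(2-)
  unfolding induced_components_def by blast

lemma Union_components: "sym E \<Longrightarrow> \<Union> (induced_components E S) = S"
  unfolding induced_components_def by (rule Union_quotient [OF equiv_connected_within])

lemma component_connected:
  assumes "sym E" "x \<in> induced_components E S" "u \<in> x" "v \<in> x"
  shows "(u, v) \<in> (E \<inter> S \<times> S)\<^sup>*"
  using quotient_eq_iff [OF equiv_connected_within [OF assms(1)], of x S x u v] assms(2-)
  by (simp add: induced_components_def)

lemma component_closed:
  assumes "sym E" "x \<in> induced_components E S" "u \<in> x" "(u, v) \<in> (E \<inter> S \<times> S)\<^sup>*" "v \<in> S"
  shows "v \<in> x"
proof -
  let ?r = "{(u, v) \<in> S \<times> S. (u, v) \<in> (E \<inter> S \<times> S)\<^sup>*}"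
  have "(u, v) \<in> ?r" using component_subset [OF assms(2)] assms(3-5) by auto
  thus ?thesis
    using in_quotient_imp_closed [OF equiv_connected_within [OF assms(1)], of x S u v] assms(2,3)
    by (simp add: induced_components_def)
qed

lemma component_mono:
  assumes "sym E" "S \<subseteq> T" "x \<in> induced_components E S" "y \<in> induced_components E T" "x \<inter> y \<noteq> {}"
  shows "x \<subseteq> y"
proof
  fix v assume v: "v \<in> x"
  obtain u where u: "u \<in> x" "u \<in> y" using assms(5) by blast
  have "E \<inter> S \<times> S \<subseteq> E \<inter> T \<times> T" using assms(2) by blast
  hence "(u, v) \<in> (E \<inter> T \<times> T)\<^sup>*"
    using component_connected [OF assms(1,3) u(1) v] by (rule subsetD [OF rtrancl_mono])
  moreover have "v \<in> T" using component_subset [OF assms(3)] assms(2) v by blast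
  ultimately show "v \<in> y" by (rule component_closed [OF assms(1,4) u(2)])
qed

lemma sum_over_components:
  assumes "sym E" "finite S" "C \<subseteq> induced_components E S"
  shows "(\<Sum>x\<in>C. \<Sum>v\<in>x. h v) = (\<Sum>v\<in>\<Union>C. h v)"
proof -
  have "\<forall>x\<in>C. finite x"
    using assms(3) component_subset finite_subset [OF _ assms(2)] by (meson subsetD)
  moreover have "\<forall>x\<in>C. \<forall>y\<in>C. x \<noteq> y \<longrightarrow> x \<inter> y = {}"
    using components_disjoint [OF assms(1)] assms(3) by blast
  ultimately show ?thesis by (simp add: sum.Union_disjoint)
qed

lemma Union_components_inside:
  assumes "sym E" "S \<subseteq> T" "y \<in> induced_components E T"
  shows "\<Union> {x \<in> induced_components E S. x \<subseteq> y} = y \<inter> S"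
proof (intro equalityI subsetI)
  fix v assume v: "v \<in> y \<inter> S"
  then obtain x where x: "x \<in> induced_components E S" "v \<in> x"
    using Union_components [OF assms(1), of S] by blast
  have "x \<inter> y \<noteq> {}" using x v by blast
  hence "x \<subseteq> y" by (rule component_mono [OF assms(1,2) x(1) assms(3)])
  thus "v \<in> \<Union> {x \<in> induced_components E S. x \<subseteq> y}" using x by blast
next
  fix v assume "v \<in> \<Union> {x \<in> induced_components E S. x \<subseteq> y}"
  thus "v \<in> y \<inter> S" using component_subset [of _ E S] by auto
qed

lemma finite_components:
  assumes "finite S"
  shows "finite (induced_components E S)"
proof (rule finite_subset)
  show "induced_components E S \<subseteq> Pow S" using component_subset [of _ E S] by auto
qed (simp add: assms)


section \<open>Lifting bold chains to the vertices\<close>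

text \<open>
  The chain \<open>c\<close> is the image of the vertex chain \<open>F\<close> under the map from vertices to components, where
  \<open>F v S\<close> is the coefficient of the vertex \<open>v\<close> in the subgraph on \<open>S\<close>.
\<close>

definition represents ::
  "'a set \<Rightarrow> 'a rel \<Rightarrow> ('a set \<times> 'a set \<Rightarrow>\<^sub>0 'k::field) \<Rightarrow> ('a \<Rightarrow> 'a set \<Rightarrow> 'k) \<Rightarrow> bool"
  where "represents V E c F \<longleftrightarrow> (\<forall>S x. Poly_Mapping.lookup c (S, x) =
    (if S \<subseteq> V \<and> x \<in> induced_components E S then \<Sum>v\<in>x. F v S else 0))"

definition vertex_family :: "'a set \<Rightarrow> int \<Rightarrow> ('a \<Rightarrow> 'a set \<Rightarrow> 'k::field) \<Rightarrow> bool"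
  where "vertex_family V i F \<longleftrightarrow> (\<forall>v. supported V {v} i (F v))"

lemma represents_diff:
  "represents V E c F \<Longrightarrow> represents V E d G \<Longrightarrow> represents V E (c - d) (\<lambda>v S. F v S - G v S)"
  by (simp add: represents_def lookup_minus sum_subtractf)

lemma represents_add:
  "represents V E c F \<Longrightarrow> represents V E d G \<Longrightarrow> represents V E (c + d) (\<lambda>v S. F v S + G v S)"
  by (simp add: represents_def lookup_add sum.distrib)

lemma represents_scale:
  "represents V E c F \<Longrightarrow> represents V E (lin_scale a c) (\<lambda>v S. a * F v S)"
  by (simp add: represents_def sum_distrib_left)

lemma represents_zero: "represents V E c (\<lambda>v S. 0) \<Longrightarrow> c = 0"
  by (rule poly_mapping_eqI) (auto simp: represents_def)

lemma keys_represented: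
  assumes "represents V E c F" "vertex_family V i F"
  shows "Poly_Mapping.keys c \<subseteq> bold_basis V E i"
proof
  fix p assume "p \<in> Poly_Mapping.keys c"
  then obtain S x where p: "p = (S, x)" "Poly_Mapping.lookup c (S, x) \<noteq> 0"
    by (cases p) (simp add: in_keys_iff)
  hence Sx: "S \<subseteq> V" "x \<in> induced_components E S" "(\<Sum>v\<in>x. F v S) \<noteq> 0"
    using assms(1) by (auto simp: represents_def split: if_splits)
  then obtain v where "F v S \<noteq> 0" by (metis sum.neutral)
  hence "int (card S) = i" using assms(2) by (auto simp: vertex_family_def supported_def)
  thus "p \<in> bold_basis V E i" using Sx p by (simp add: bold_basis_def)
qed

text \<open>
  The coefficient of a component is placed at its least vertex.
\<close>

lemma bold_chain_lift:
  fixes V :: "'a::linorder set"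
  assumes "sym E" "finite V" and c: "Poly_Mapping.keys c \<subseteq> bold_basis V E i"
  shows "\<exists>F. vertex_family V i F \<and> represents V E c F"
proof -
  define F where "F v S = (\<Sum>x | x \<in> induced_components E S \<and> v = Min x. Poly_Mapping.lookup c (S, x))" for v S
  have Min: "Min x \<in> x" if "S \<subseteq> V" "x \<in> induced_components E S" for x S
    using component_subset [OF that(2)] component_nonempty [OF that(2)] that(1) assms(2)
    by (meson Min_in finite_subset)
  have "vertex_family V i F"
    unfolding vertex_family_def supported_def
  proof (intro allI impI)
    fix v S assume "F v S \<noteq> 0"
    then obtain x where x: "x \<in> induced_components E S" "v = Min x" "Poly_Mapping.lookup c (S, x) \<noteq> 0"
      unfolding F_def by (metis (mono_tags, lifting) mem_Collect_eq sum.neutral)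
    hence "(S, x) \<in> bold_basis V E i" using c by (auto simp: in_keys_iff)
    hence "S \<subseteq> V" "int (card S) = i" by (simp_all add: bold_basis_def)
    thus "S \<subseteq> V \<and> {v} \<subseteq> S \<and> int (card S) = i"
      using Min [of S x] component_subset [OF x(1)] x by auto
  qed
  moreover have "Poly_Mapping.lookup c (S, x) =
      (if S \<subseteq> V \<and> x \<in> induced_components E S then \<Sum>v\<in>x. F v S else 0)" for S x
  proof (cases "S \<subseteq> V \<and> x \<in> induced_components E S")
    case True
    have "F v S = (if v = Min x then Poly_Mapping.lookup c (S, x) else 0)" if v: "v \<in> x" for v
    proof -
      have "y = x" if "y \<in> induced_components E S" "v = Min y" for y
        using components_disjoint [OF assms(1) that(1), of x] Min [of S y] that True v by blast
      hence "{y. y \<in> induced_components E S \<and> v = Min y} = (if v = Min x then {x} else {})"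
        using True by auto
      thus ?thesis by (simp add: F_def)
    qed
    hence "(\<Sum>v\<in>x. F v S) = (\<Sum>v\<in>x. if v = Min x then Poly_Mapping.lookup c (S, x) else 0)"
      by (intro sum.cong) auto
    also have "\<dots> = Poly_Mapping.lookup c (S, x)"
    proof -
      have "finite x" using True component_subset [of x E S] assms(2) by (meson finite_subset)
      thus ?thesis using Min [of S x] True by simp
    qed
    finally show ?thesis using True by simp
  next
    case False
    hence "(S, x) \<notin> bold_basis V E i" by (auto simp: bold_basis_def)
    thus ?thesis using False c by (auto simp: in_keys_iff)
  qed
  ultimately show ?thesis by (auto simp: represents_def)
qed

lemma bold_chain_of_family:
  assumes "finite V"
  shows "\<exists>c. represents V E c F"
proof -
  define f where "f = (\<lambda>(S, x). if S \<subseteq> V \<and> x \<in> induced_components E S then \<Sum>v\<in>x. F v S else 0)"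
  have "p \<in> Pow V \<times> Pow V" if "f p \<noteq> 0" for p
    using that component_subset [of "snd p" E "fst p"]
    by (cases p) (auto simp: f_def split: if_splits)
  hence "{p. f p \<noteq> 0} \<subseteq> Pow V \<times> Pow V" by blast
  hence "finite {p. f p \<noteq> 0}" using assms finite_subset by blast
  hence "represents V E (Abs_poly_mapping f) F"
    by (simp add: represents_def f_def)
  thus ?thesis by blast
qed

lemma lookup_bold_diff:
  assumes "finite V"
  shows "Poly_Mapping.lookup (bold_diff V E s (S, x)) (T, y) =
    (if colour_step V S T \<and> y \<in> induced_components E T \<and> x \<subseteq> y then bit_sign (s S T) else 0)"
proof -
  let ?A = "{(T, y). colour_step V S T \<and> y \<in> induced_components E T \<and> x \<subseteq> y}"
  have "p \<in> Pow V \<times> Pow V" if "p \<in> ?A" for p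
    using that component_subset [of "snd p" E "fst p"] by (cases p) (auto simp: colour_step_def)
  hence "?A \<subseteq> Pow V \<times> Pow V" by blast
  hence "finite ?A" using assms finite_subset by blast
  have "Poly_Mapping.lookup (bold_diff V E s (S, x)) (T, y) =
      (\<Sum>p\<in>?A. if p = (T, y) then bit_sign (s S T) else 0)"
    unfolding bold_diff_def prod.case lookup_sum
    by (intro sum.cong refl) (simp add: lookup_single when_def bit_sign_def split: prod.split)
  also have "\<dots> = (if (T, y) \<in> ?A then bit_sign (s S T) else 0)"
    using \<open>finite ?A\<close> by (simp only: sum.delta)
  finally show ?thesis by simp
qed

text \<open>
  The map from vertices to components commutes with the differentials: the coefficient of a component
  \<open>y\<close> in the differential of \<open>c\<close> collects all components inside \<open>y\<close>, and thus all vertices of \<open>y\<close>, however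
  these were divided into components before. On the vertex side the differential acts on each \<open>F v\<close> separately.
\<close>

lemma represents_bold_diff:
  assumes "sym E" "finite V" and c: "represents V E c F" and F: "vertex_family V i F"
  shows "represents V E (lin_extend (bold_diff V E s) c) (\<lambda>v. cube_diff V s (F v))"
  unfolding represents_def
proof (intro allI)
  fix T y
  let ?B = "Sigma (Pow V) (induced_components E)"
  have finB: "finite ?B"
    using assms(2) finite_components finite_subset by (intro finite_SigmaI) auto
  have finS: "finite S" if "S \<subseteq> V" for S using that assms(2) finite_subset by blast
  have "Poly_Mapping.keys c \<subseteq> ?B"
    using keys_represented [OF c F] by (auto simp: bold_basis_def)
  hence "Poly_Mapping.lookup (lin_extend (bold_diff V E s) c) (T, y) =
      (\<Sum>(S, x)\<in>?B. Poly_Mapping.lookup c (S, x) *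
        Poly_Mapping.lookup (bold_diff V E s (S, x)) (T, y))"
    by (simp add: lookup_lin_extend_superset [OF finB] case_prod_unfold)
  also have "\<dots> = (\<Sum>S\<in>Pow V. \<Sum>x\<in>induced_components E S. Poly_Mapping.lookup c (S, x) *
        Poly_Mapping.lookup (bold_diff V E s (S, x)) (T, y))"
    using assms(2) finite_components finS by (intro sum.Sigma [symmetric]) auto
  also have "\<dots> = (if T \<subseteq> V \<and> y \<in> induced_components E T then \<Sum>v\<in>y. cube_diff V s (F v) T else 0)"
  proof (cases "T \<subseteq> V \<and> y \<in> induced_components E T")
    case False
    have zero: "Poly_Mapping.lookup (bold_diff V E s (S, x)) (T, y) = (0::'b)" for S x
    proof -
      have "\<not> (colour_step V S T \<and> y \<in> induced_components E T)"
        using False by (auto simp: colour_step_def)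
      thus ?thesis unfolding lookup_bold_diff [OF assms(2)] by auto
    qed
    show ?thesis by (simp only: if_not_P [OF False] zero mult_zero_right sum.neutral_const)
  next
    case True
    have inner: "(\<Sum>x\<in>induced_components E S. Poly_Mapping.lookup c (S, x) *
        Poly_Mapping.lookup (bold_diff V E s (S, x)) (T, y)) =
        (if colour_step V S T then bit_sign (s S T) * (\<Sum>v\<in>y. F v S) else 0)" if S: "S \<subseteq> V" for S
    proof (cases "colour_step V S T")
      case step: True
      let ?C = "{x \<in> induced_components E S. x \<subseteq> y}"
      have ST: "S \<subseteq> T" using step by (auto simp: colour_step_def)
      have "(\<Sum>x\<in>induced_components E S. Poly_Mapping.lookup c (S, x) *
          Poly_Mapping.lookup (bold_diff V E s (S, x)) (T, y)) =
          (\<Sum>x\<in>?C. bit_sign (s S T) * (\<Sum>v\<in>x. F v S))"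
        using c S True step finite_components [OF finS [OF S]]
        by (intro sum.mono_neutral_cong_right)
           (auto simp: lookup_bold_diff [OF assms(2)] represents_def)
      also have "\<dots> = bit_sign (s S T) * (\<Sum>v\<in>y \<inter> S. F v S)"
        using sum_over_components [OF assms(1) finS [OF S], of ?C "\<lambda>v. F v S"]
          Union_components_inside [OF assms(1) ST] True
        by (simp add: sum_distrib_left [symmetric])
      also have "(\<Sum>v\<in>y \<inter> S. F v S) = (\<Sum>v\<in>y. F v S)"
        using F True component_subset [of y E T] finS
        by (intro sum.mono_neutral_left) (auto simp: vertex_family_def supported_def intro: finite_subset)
      finally show ?thesis using step by simp
    qed (simp add: lookup_bold_diff [OF assms(2)])
    have "(\<Sum>S\<in>Pow V. \<Sum>x\<in>induced_components E S. Poly_Mapping.lookup c (S, x) *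
        Poly_Mapping.lookup (bold_diff V E s (S, x)) (T, y)) =
        (\<Sum>S\<in>Pow V. if colour_step V S T then bit_sign (s S T) * (\<Sum>v\<in>y. F v S) else 0)"
      by (intro sum.cong refl inner) simp
    also have "\<dots> = (\<Sum>S | colour_step V S T. bit_sign (s S T) * (\<Sum>v\<in>y. F v S))"
      using assms(2) by (intro sum.mono_neutral_cong_right) (auto simp: colour_step_def)
    also have "\<dots> = (\<Sum>v\<in>y. cube_diff V s (F v) T)"
      unfolding cube_diff_def sum_distrib_left by (rule sum.swap)
    finally show ?thesis using True by simp
  qed
  finally show "Poly_Mapping.lookup (lin_extend (bold_diff V E s) c) (T, y) =
    (if T \<subseteq> V \<and> y \<in> induced_components E T then \<Sum>v\<in>y. cube_diff V s (F v) T else 0)" .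
qed

lemma vertex_family_cube_diff:
  "finite V \<Longrightarrow> vertex_family V i F \<Longrightarrow> vertex_family V (i + 1) (\<lambda>v. cube_diff V s (F v))"
  by (simp add: vertex_family_def supported_cube_diff)

lemma bold_boundaries_subset_cycles:
  fixes V :: "'a::linorder set"
  assumes "sym E" "finite V" "sign_assignment V s"
  shows "boundary_space (bold_basis V E (i - 1)) (bold_diff V E s) \<subseteq>
    (cycle_space (bold_basis V E i) (bold_diff V E s) :: (_ \<Rightarrow>\<^sub>0 'k::field) set)"
proof
  fix c :: "_ \<Rightarrow>\<^sub>0 'k" assume "c \<in> boundary_space (bold_basis V E (i - 1)) (bold_diff V E s)"
  then obtain b where b: "c = lin_extend (bold_diff V E s) b" "Poly_Mapping.keys b \<subseteq> bold_basis V E (i - 1)"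
    by (auto simp: boundary_space_def)
  then obtain M where M: "vertex_family V (i - 1) M" "represents V E b M"
    using bold_chain_lift [OF assms(1,2)] by blast
  have c: "represents V E c (\<lambda>v. cube_diff V s (M v))"
    unfolding b(1) by (rule represents_bold_diff [OF assms(1,2) M(2,1)])
  have c': "vertex_family V i (\<lambda>v. cube_diff V s (M v))"
    using vertex_family_cube_diff [OF assms(2) M(1)] by simp
  have "represents V E (lin_extend (bold_diff V E s) c) (\<lambda>v. cube_diff V s (cube_diff V s (M v)))"
    by (rule represents_bold_diff [OF assms(1,2) c c'])
  hence "represents V E (lin_extend (bold_diff V E s) c) (\<lambda>v S. 0)"
    by (simp add: cube_diff_cube_diff [OF assms(2,3)])
  thus "c \<in> cycle_space (bold_basis V E i) (bold_diff V E s)"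
    using represents_zero keys_represented [OF c c'] by (auto simp: cycle_space_def)
qed


section \<open>The cycle graph\<close>

definition cyc_succ :: "nat \<Rightarrow> nat \<Rightarrow> nat"
  where "cyc_succ n j = (if Suc j = n then 0 else Suc j)"

definition cyc_pred :: "nat \<Rightarrow> nat \<Rightarrow> nat"
  where "cyc_pred n v = (if v = 0 then n - 1 else v - 1)"

lemma cyc_succ_less: "j < n \<Longrightarrow> cyc_succ n j < n"
  by (auto simp: cyc_succ_def)

lemma cyc_pred_less: "v < n \<Longrightarrow> cyc_pred n v < n"
  by (auto simp: cyc_pred_def)

lemma cyc_succ_pred: "v < n \<Longrightarrow> cyc_succ n (cyc_pred n v) = v"
  by (auto simp: cyc_succ_def cyc_pred_def)

lemma cyc_pred_eq_iff: "v < n \<Longrightarrow> j < n \<Longrightarrow> cyc_pred n v = j \<longleftrightarrow> v = cyc_succ n j"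
  by (auto simp: cyc_succ_def cyc_pred_def)

lemma cycle_edges_iff:
  "(i, j) \<in> cycle_edges n \<longleftrightarrow> i < n \<and> j < n \<and> (j = cyc_succ n i \<or> i = cyc_succ n j)"
  by (auto simp: cycle_edges_def cyc_succ_def mod_Suc)

lemma sym_cycle_edges: "sym (cycle_edges n)"
  by (auto simp: sym_def cycle_edges_iff)

text \<open>
  The edge \<open>j\<close> joins the vertices \<open>j\<close> and \<open>j + 1\<close> modulo \<open>n\<close>.
\<close>

definition edge_family :: "nat \<Rightarrow> int \<Rightarrow> (nat \<Rightarrow> nat set \<Rightarrow> 'k::field) \<Rightarrow> bool"
  where "edge_family n i G \<longleftrightarrow> (\<forall>j. supported {..<n} {j, cyc_succ n j} i (G j))"

text \<open>
  The simplicial boundary in the subgraph on \<open>S\<close>, with all edges directed around the cycle: \<open>v\<close> is the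
  end of the edge before it and the start of its own edge.
\<close>

definition edge_bd :: "nat \<Rightarrow> (nat \<Rightarrow> nat set \<Rightarrow> 'k::field) \<Rightarrow> nat \<Rightarrow> nat set \<Rightarrow> 'k"
  where "edge_bd n G v S = (if v < n then G (cyc_pred n v) S - G v S else 0)"

lemma edge_bd_diff: "edge_bd n (\<lambda>j S. G j S - H j S) v S = edge_bd n G v S - edge_bd n H v S"
  by (simp add: edge_bd_def)

lemma edge_bd_add: "edge_bd n (\<lambda>j S. G j S + H j S) v S = edge_bd n G v S + edge_bd n H v S"
  by (simp add: edge_bd_def)

lemma edge_bd_scale: "edge_bd n (\<lambda>j S. a * G j S) v S = a * edge_bd n G v S"
  by (simp add: edge_bd_def algebra_simps)

lemma cube_diff_edge_bd:
  "cube_diff V s (edge_bd n G v) = edge_bd n (\<lambda>j. cube_diff V s (G j)) v"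
proof (cases "v < n")
  case True
  hence "edge_bd n G v = (\<lambda>S. G (cyc_pred n v) S - G v S)" by (auto simp: edge_bd_def)
  thus ?thesis using True by (auto simp: cube_diff_diff edge_bd_def)
next
  case False
  hence "edge_bd n G v = (\<lambda>S. 0)" by (auto simp: edge_bd_def)
  thus ?thesis using False by (auto simp: edge_bd_def)
qed

lemma vertex_family_edge_bd:
  assumes "edge_family n i G"
  shows "vertex_family {..<n} i (edge_bd n G)"
  unfolding vertex_family_def supported_def
proof (intro allI impI)
  fix v S assume nz: "edge_bd n G v S \<noteq> 0"
  hence v: "v < n" by (auto simp: edge_bd_def split: if_splits)
  have sup: "G j S \<noteq> 0 \<Longrightarrow> S \<subseteq> {..<n} \<and> {j, cyc_succ n j} \<subseteq> S \<and> int (card S) = i" for j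
    using assms unfolding edge_family_def supported_def by blast
  have "G (cyc_pred n v) S \<noteq> 0 \<or> G v S \<noteq> 0" using nz v by (auto simp: edge_bd_def)
  thus "S \<subseteq> {..<n} \<and> {v} \<subseteq> S \<and> int (card S) = i"
    using sup [of v] sup [of "cyc_pred n v"] cyc_succ_pred [OF v] by auto
qed

lemma edge_family_cube_diff:
  "edge_family n i G \<Longrightarrow> edge_family n (i + 1) (\<lambda>j. cube_diff {..<n} s (G j))"
  by (simp add: edge_family_def supported_cube_diff)

lemma edge_family_outside:
  assumes "edge_family n i G" "\<not> j < n"
  shows "G j S = 0"
proof (rule ccontr)
  assume "G j S \<noteq> 0"
  hence "S \<subseteq> {..<n}" "j \<in> S" using assms(1) unfolding edge_family_def supported_def by blast+
  thus False using assms(2) by auto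
qed

lemma edge_bd_eq_0_imp_constant:
  assumes "\<And>v. edge_bd n G v S = 0" "j < n"
  shows "G j S = G 0 S"
  using assms(2)
proof (induction j)
  case (Suc j)
  have "G j S - G (Suc j) S = 0"
    using assms(1) [of "Suc j"] Suc.prems by (simp add: edge_bd_def cyc_pred_def)
  thus ?case using Suc by simp
qed simp

text \<open>
  An edge chain without boundary has the same coefficient at all edges, and all edges together span
  the whole vertex set: the only cycle is the fundamental one.
\<close>

lemma edge_bd_eq_0_imp_top:
  assumes G: "edge_family n i G" and bd: "\<And>v. edge_bd n G v S = 0" and nz: "G 0 S \<noteq> 0"
  shows "S = {..<n}"
proof
  show "S \<subseteq> {..<n}" using G nz unfolding edge_family_def supported_def by blast
  show "{..<n} \<subseteq> S"
  proof
    fix j assume "j \<in> {..<n}"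
    hence "G j S \<noteq> 0" using edge_bd_eq_0_imp_constant [of n G S j, OF bd] nz by simp
    thus "j \<in> S" using G unfolding edge_family_def supported_def by blast
  qed
qed

text \<open>
  Both ends of an edge lie in the same component and contribute opposite signs.
\<close>

lemma edge_bd_component_sum:
  assumes G: "edge_family n i G" and S: "S \<subseteq> {..<n}" and x: "x \<in> induced_components (cycle_edges n) S"
  shows "(\<Sum>v\<in>x. edge_bd n G v S) = 0"
proof -
  have xS: "x \<subseteq> S" using x by (rule component_subset)
  have fin: "finite x" using xS S by (meson finite_lessThan finite_subset)
  have sup: "G j S \<noteq> 0 \<Longrightarrow> j \<in> S \<and> cyc_succ n j \<in> S" for j
    using G unfolding edge_family_def supported_def by blast
  have both: "j \<in> x \<longleftrightarrow> cyc_succ n j \<in> x" if "G j S \<noteq> 0" for j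
  proof -
    have jS: "j \<in> S" "cyc_succ n j \<in> S" using sup [OF that] by auto
    hence "(j, cyc_succ n j) \<in> cycle_edges n \<inter> S \<times> S" "(cyc_succ n j, j) \<in> cycle_edges n \<inter> S \<times> S"
      using S by (auto simp: cycle_edges_iff)
    thus ?thesis
      using component_closed [OF sym_cycle_edges x _ r_into_rtrancl] jS by metis
  qed
  have "(\<Sum>v\<in>x. G (cyc_pred n v) S) = (\<Sum>j\<in>cyc_pred n ` x. G j S)"
  proof -
    have "inj_on (cyc_pred n) x"
      using xS S cyc_succ_pred by (intro inj_on_inverseI [of _ "cyc_succ n"]) auto
    thus ?thesis by (simp add: sum.reindex)
  qed
  also have "\<dots> = (\<Sum>j\<in>cyc_pred n ` x \<union> x. G j S)"
  proof (intro sum.mono_neutral_left ballI)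
    fix j assume j: "j \<in> cyc_pred n ` x \<union> x - cyc_pred n ` x"
    show "G j S = 0"
    proof (rule ccontr)
      assume nz: "G j S \<noteq> 0"
      have "cyc_succ n j \<in> x" using both [OF nz] j by blast
      moreover have "j = cyc_pred n (cyc_succ n j)"
      proof -
        have "j < n" "cyc_succ n j < n" using sup [OF nz] S by auto
        thus ?thesis using cyc_pred_eq_iff by metis
      qed
      ultimately have "j \<in> cyc_pred n ` x" by blast
      thus False using j by blast
    qed
  qed (use fin in auto)
  also have "\<dots> = (\<Sum>j\<in>x. G j S)"
  proof (intro sum.mono_neutral_right ballI)
    fix j assume j: "j \<in> cyc_pred n ` x \<union> x - x"
    then obtain v where v: "v \<in> x" "j = cyc_pred n v" by blast
    hence "cyc_succ n j \<in> x" using xS S cyc_succ_pred by auto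
    thus "G j S = 0" using both [of j] j by blast
  qed (use fin in auto)
  finally have eq: "(\<Sum>v\<in>x. G (cyc_pred n v) S) = (\<Sum>j\<in>x. G j S)" .
  have "(\<Sum>v\<in>x. edge_bd n G v S) = (\<Sum>v\<in>x. G (cyc_pred n v) S - G v S)"
    using xS S by (intro sum.cong) (auto simp: edge_bd_def)
  thus ?thesis by (simp add: eq sum_subtractf)
qed

lemma represents_edge_bd:
  assumes "represents {..<n} (cycle_edges n) c (edge_bd n G)" "edge_family n i G"
  shows "c = 0"
  using assms(1) edge_bd_component_sum [OF assms(2)]
  by (intro represents_zero) (auto simp: represents_def)

text \<open>
  The function \<open>f\<close> is the boundary of a \<open>1\<close>-chain of the subgraph induced by \<open>S\<close>.
\<close>

definition edge_boundary_on :: "nat \<Rightarrow> nat set \<Rightarrow> (nat \<Rightarrow> 'k::field) \<Rightarrow> bool"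
  where "edge_boundary_on n S f \<longleftrightarrow>
    (\<exists>g. (\<forall>j. g j \<noteq> 0 \<longrightarrow> j \<in> S \<and> cyc_succ n j \<in> S) \<and> (\<forall>v<n. f v = g (cyc_pred n v) - g v))"

lemma edge_boundary_on_add:
  assumes "edge_boundary_on n S f" "edge_boundary_on n S f'"
  shows "edge_boundary_on n S (\<lambda>v. f v + f' v)"
proof -
  obtain g where g: "\<forall>j. g j \<noteq> 0 \<longrightarrow> j \<in> S \<and> cyc_succ n j \<in> S" "\<forall>v<n. f v = g (cyc_pred n v) - g v"
    using assms(1) by (auto simp: edge_boundary_on_def)
  obtain g' where g': "\<forall>j. g' j \<noteq> 0 \<longrightarrow> j \<in> S \<and> cyc_succ n j \<in> S" "\<forall>v<n. f' v = g' (cyc_pred n v) - g' v"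
    using assms(2) by (auto simp: edge_boundary_on_def)
  have "j \<in> S \<and> cyc_succ n j \<in> S" if "g j + g' j \<noteq> 0" for j
    using that g(1) g'(1) by (metis add.left_neutral)
  thus ?thesis
    unfolding edge_boundary_on_def using g(2) g'(2)
    by (intro exI [of _ "\<lambda>j. g j + g' j"]) auto
qed

lemma edge_boundary_on_scale:
  assumes "edge_boundary_on n S f"
  shows "edge_boundary_on n S (\<lambda>v. a * f v)"
proof -
  obtain g where g: "\<forall>j. g j \<noteq> 0 \<longrightarrow> j \<in> S \<and> cyc_succ n j \<in> S" "\<forall>v<n. f v = g (cyc_pred n v) - g v"
    using assms by (auto simp: edge_boundary_on_def)
  show ?thesis
    unfolding edge_boundary_on_def using g
    by (intro exI [of _ "\<lambda>j. a * g j"]) (auto simp: right_diff_distrib)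
qed

lemma edge_boundary_on_0: "edge_boundary_on n S (\<lambda>v. 0)"
  unfolding edge_boundary_on_def by (intro exI [of _ "\<lambda>_. 0"]) simp

lemma edge_boundary_on_sum:
  assumes "\<And>a. a \<in> A \<Longrightarrow> edge_boundary_on n S (f a)"
  shows "edge_boundary_on n S (\<lambda>v. \<Sum>a\<in>A. f a v)"
  using assms
  by (induction A rule: infinite_finite_induct) (auto intro: edge_boundary_on_0 edge_boundary_on_add)

lemma edge_boundary_on_edge:
  assumes "j < n" "j \<in> S" "cyc_succ n j \<in> S"
  shows "edge_boundary_on n S (\<lambda>v. (if v = cyc_succ n j then 1 else 0) - (if v = j then 1 else 0))"
  unfolding edge_boundary_on_def
  by (rule exI [of _ "\<lambda>i. if i = j then 1 else 0"])
     (use assms in \<open>auto simp: cyc_pred_eq_iff\<close>)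

text \<open>
  The sum of the edges along a path has the difference of the ends as its boundary.
\<close>

lemma edge_boundary_on_path:
  assumes "(u, w) \<in> (cycle_edges n \<inter> S \<times> S)\<^sup>*"
  shows "edge_boundary_on n S (\<lambda>v. (if v = w then 1 else 0) - (if v = u then 1 else 0 :: 'k::field))"
  using assms
proof (induction rule: rtrancl_induct)
  case base
  show ?case by (simp add: edge_boundary_on_0)
next
  case (step w t)
  have wt: "w \<in> S" "t \<in> S" "w < n" "t < n" "t = cyc_succ n w \<or> w = cyc_succ n t"
    using step.hyps(2) by (auto simp: cycle_edges_iff)
  have "edge_boundary_on n S (\<lambda>v. (if v = t then 1 else 0) - (if v = w then 1 else 0 :: 'k))"
    using wt(5)
  proof
    assume "t = cyc_succ n w"
    thus ?thesis using edge_boundary_on_edge [of w n S, where 'a = 'k] wt by simp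
  next
    assume "w = cyc_succ n t"
    hence "edge_boundary_on n S (\<lambda>v. - 1 * ((if v = w then 1 else 0) - (if v = t then 1 else 0 :: 'k)))"
      using edge_boundary_on_edge [of t n S, where 'a = 'k] wt by (intro edge_boundary_on_scale) simp
    thus ?thesis by simp
  qed
  from edge_boundary_on_add [OF step.IH this] show ?case by simp
qed

text \<open>
  With a base vertex \<open>\<rho> x\<close> in each component \<open>x\<close>, the function is a combination of differences \<open>v - \<rho> x\<close>
  with \<open>v \<in> x\<close>, because the total coefficient at \<open>\<rho> x\<close> is the sum over the component. Each difference
  bounds a path.
\<close>

lemma edge_boundary_on_if_component_sums_0:
  fixes f :: "nat \<Rightarrow> 'k::field"
  assumes S: "finite S" and f: "\<And>v. f v \<noteq> 0 \<Longrightarrow> v \<in> S"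
    and sums: "\<And>x. x \<in> induced_components (cycle_edges n) S \<Longrightarrow> (\<Sum>v\<in>x. f v) = 0"
  shows "edge_boundary_on n S f"
proof -
  let ?C = "induced_components (cycle_edges n) S"
  define \<rho> where "\<rho> x = (SOME v. v \<in> x)" for x :: "nat set"
  have \<rho>: "\<rho> x \<in> x" if "x \<in> ?C" for x
    using component_nonempty [OF that] by (simp add: \<rho>_def some_in_eq)
  have "edge_boundary_on n S (\<lambda>t. \<Sum>x\<in>?C. \<Sum>v\<in>x.
      f v * ((if t = v then 1 else 0) - (if t = \<rho> x then 1 else 0)))"
    using component_connected [OF sym_cycle_edges _ \<rho>]
    by (intro edge_boundary_on_sum edge_boundary_on_scale edge_boundary_on_path)
  moreover have "(\<Sum>x\<in>?C. \<Sum>v\<in>x. f v * ((if t = v then 1 else 0) - (if t = \<rho> x then 1 else 0))) = f t" for t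
  proof -
    have "(\<Sum>v\<in>x. f v * ((if t = v then 1 else 0) - (if t = \<rho> x then 1 else 0))) =
        (\<Sum>v\<in>x. f v * (if t = v then 1 else 0))" if "x \<in> ?C" for x
      using sums [OF that]
      by (simp only: right_diff_distrib sum_subtractf sum_distrib_right [symmetric]) simp
    hence "(\<Sum>x\<in>?C. \<Sum>v\<in>x. f v * ((if t = v then 1 else 0) - (if t = \<rho> x then 1 else 0))) =
        (\<Sum>x\<in>?C. \<Sum>v\<in>x. f v * (if t = v then 1 else 0))"
      by (rule sum.cong [OF refl])
    also have "\<dots> = (\<Sum>v\<in>S. f v * (if t = v then 1 else 0))"
      using sum_over_components [OF sym_cycle_edges S order_refl]
      by (simp only: Union_components [OF sym_cycle_edges])
    also have "\<dots> = (\<Sum>v\<in>S. if v = t then f v else 0)"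
      by (intro sum.cong) auto
    also have "\<dots> = f t" using S f [of t] by (auto simp: sum.delta)
    finally show ?thesis .
  qed
  ultimately show ?thesis by simp
qed

text \<open>
  Exactness at the vertices.
\<close>

lemma represents_0_imp_edge_bd:
  assumes F: "vertex_family {..<n} i F" and zero: "represents {..<n} (cycle_edges n) 0 F"
  shows "\<exists>G. edge_family n i G \<and> F = edge_bd n G"
proof -
  have "\<exists>g. (\<forall>j. g j \<noteq> 0 \<longrightarrow> S \<subseteq> {..<n} \<and> {j, cyc_succ n j} \<subseteq> S \<and> int (card S) = i) \<and>
      (\<forall>v<n. F v S = g (cyc_pred n v) - g v)" for S
  proof (cases "\<forall>v. F v S = 0")
    case True
    thus ?thesis by (intro exI [of _ "\<lambda>_. 0"]) simp
  next
    case False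
    hence S: "S \<subseteq> {..<n}" "int (card S) = i"
      using F unfolding vertex_family_def supported_def by blast+
    have "edge_boundary_on n S (\<lambda>v. F v S)"
    proof (rule edge_boundary_on_if_component_sums_0)
      show "finite S" using S(1) finite_subset by blast
      show "v \<in> S" if "F v S \<noteq> 0" for v
        using F that unfolding vertex_family_def supported_def by blast
      show "(\<Sum>v\<in>x. F v S) = 0" if "x \<in> induced_components (cycle_edges n) S" for x
      proof -
        have "Poly_Mapping.lookup 0 (S, x) = (\<Sum>v\<in>x. F v S)"
          using zero that S(1) unfolding represents_def by meson
        thus ?thesis by simp
      qed
    qed
    thus ?thesis using S unfolding edge_boundary_on_def by auto
  qed
  then obtain g where g: "\<And>S j. g S j \<noteq> 0 \<Longrightarrow> S \<subseteq> {..<n} \<and> {j, cyc_succ n j} \<subseteq> S \<and> int (card S) = i"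
      "\<And>S v. v < n \<Longrightarrow> F v S = g S (cyc_pred n v) - g S v"
    by metis
  have "edge_family n i (\<lambda>j S. g S j)" using g(1) by (simp add: edge_family_def supported_def)
  moreover have "F v S = edge_bd n (\<lambda>j S. g S j) v S" for v S
  proof (cases "v < n")
    case False
    have "F v S = 0"
      using F False unfolding vertex_family_def supported_def by (metis insert_subset lessThan_iff subsetD)
    thus ?thesis using False by (simp add: edge_bd_def)
  qed (simp add: edge_bd_def g(2))
  ultimately show ?thesis by blast
qed


section \<open>Bold homology of the cycle graph\<close>

text \<open>
  The double connecting homomorphism. A cycle \<open>c\<close> lifts to a vertex chain \<open>F\<close>, whose differential maps to
  \<open>0\<close> on components and so is the boundary of an edge chain \<open>G\<close>. The differential of \<open>G\<close> has no boundary,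
  and so it is a multiple \<open>a\<close> of the fundamental cycle; \<open>a\<close> can be read off at any edge, here the edge \<open>0\<close>.
\<close>

definition winding ::
  "nat \<Rightarrow> (nat set \<Rightarrow> nat set \<Rightarrow> bit) \<Rightarrow> int \<Rightarrow> (nat set \<times> nat set \<Rightarrow>\<^sub>0 'k::field) \<Rightarrow> 'k \<Rightarrow> bool"
  where "winding n s i c a \<longleftrightarrow> (\<exists>F G.
    vertex_family {..<n} i F \<and> represents {..<n} (cycle_edges n) c F \<and>
    edge_family n (i + 1) G \<and> (\<forall>v. cube_diff {..<n} s (F v) = edge_bd n G v) \<and>
    cube_diff {..<n} s (G 0) {..<n} = a)"

lemma winding_add:
  assumes "winding n s i c a" "winding n s i d b"
  shows "winding n s i (c + d) (a + b)"
proof -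
  obtain F G where 1: "vertex_family {..<n} i F" "represents {..<n} (cycle_edges n) c F"
      "edge_family n (i + 1) G" "\<And>v. cube_diff {..<n} s (F v) = edge_bd n G v"
      "cube_diff {..<n} s (G 0) {..<n} = a"
    using assms(1) unfolding winding_def by blast
  obtain F' G' where 2: "vertex_family {..<n} i F'" "represents {..<n} (cycle_edges n) d F'"
      "edge_family n (i + 1) G'" "\<And>v. cube_diff {..<n} s (F' v) = edge_bd n G' v"
      "cube_diff {..<n} s (G' 0) {..<n} = b"
    using assms(2) unfolding winding_def by blast
  show ?thesis
    unfolding winding_def
  proof (intro exI conjI allI)
    show "vertex_family {..<n} i (\<lambda>v S. F v S + F' v S)"
      using 1(1) 2(1) by (simp add: vertex_family_def supported_add)
    show "represents {..<n} (cycle_edges n) (c + d) (\<lambda>v S. F v S + F' v S)"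
      using 1(2) 2(2) by (rule represents_add)
    show "edge_family n (i + 1) (\<lambda>j S. G j S + G' j S)"
      using 1(3) 2(3) by (simp add: edge_family_def supported_add)
    show "cube_diff {..<n} s (\<lambda>S. F v S + F' v S) = edge_bd n (\<lambda>j S. G j S + G' j S) v" for v
      by (simp add: fun_eq_iff cube_diff_add edge_bd_add 1(4) 2(4))
    show "cube_diff {..<n} s (\<lambda>S. G 0 S + G' 0 S) {..<n} = a + b"
      by (simp add: cube_diff_add 1(5) 2(5))
  qed
qed

lemma winding_scale:
  assumes "winding n s i c a"
  shows "winding n s i (lin_scale t c) (t * a)"
proof -
  obtain F G where 1: "vertex_family {..<n} i F" "represents {..<n} (cycle_edges n) c F"
      "edge_family n (i + 1) G" "\<And>v. cube_diff {..<n} s (F v) = edge_bd n G v"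
      "cube_diff {..<n} s (G 0) {..<n} = a"
    using assms(1) unfolding winding_def by blast
  show ?thesis
    unfolding winding_def
  proof (intro exI conjI allI)
    show "vertex_family {..<n} i (\<lambda>v S. t * F v S)"
      using 1(1) by (simp add: vertex_family_def supported_scale)
    show "represents {..<n} (cycle_edges n) (lin_scale t c) (\<lambda>v S. t * F v S)"
      using 1(2) by (rule represents_scale)
    show "edge_family n (i + 1) (\<lambda>j S. t * G j S)"
      using 1(3) by (simp add: edge_family_def supported_scale)
    show "cube_diff {..<n} s (\<lambda>S. t * F v S) = edge_bd n (\<lambda>j S. t * G j S) v" for v
      by (simp add: fun_eq_iff cube_diff_scale edge_bd_scale 1(4))
    show "cube_diff {..<n} s (\<lambda>S. t * G 0 S) {..<n} = t * a"
      by (simp add: cube_diff_scale 1(5))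
  qed
qed

lemma winding_exists:
  assumes c: "c \<in> cycle_space (bold_basis {..<n} (cycle_edges n) i) (bold_diff {..<n} (cycle_edges n) s)"
  shows "\<exists>a. winding n s i c a"
proof -
  obtain F where F: "vertex_family {..<n} i F" "represents {..<n} (cycle_edges n) c F"
    using bold_chain_lift [OF sym_cycle_edges, of "{..<n}" c n i] c by (auto simp: cycle_space_def)
  have "represents {..<n} (cycle_edges n) 0 (\<lambda>v. cube_diff {..<n} s (F v))"
    using represents_bold_diff [OF sym_cycle_edges _ F(2,1), of s] c by (simp add: cycle_space_def)
  moreover have "vertex_family {..<n} (i + 1) (\<lambda>v. cube_diff {..<n} s (F v))"
    using F(1) by (simp add: vertex_family_cube_diff)
  ultimately obtain G where "edge_family n (i + 1) G" "(\<lambda>v. cube_diff {..<n} s (F v)) = edge_bd n G"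
    using represents_0_imp_edge_bd by blast
  thus ?thesis unfolding winding_def using F by metis
qed

text \<open>
  The two steps raise the degree by two, and the fundamental cycle has degree \<open>n\<close>.
\<close>

lemma winding_degree:
  assumes "winding n s i c a" "a \<noteq> 0"
  shows "i = int n - 2"
proof -
  obtain G where "edge_family n (i + 1) G" "cube_diff {..<n} s (G 0) {..<n} = a"
    using assms(1) unfolding winding_def by blast
  hence "int (card {..<n}) = i + 1 + 1"
    using edge_family_cube_diff [of n "i + 1" G s] \<open>a \<noteq> 0\<close>
    unfolding edge_family_def supported_def by blast
  thus ?thesis by simp
qed

text \<open>
  If \<open>c\<close> is the differential of a chain with lift \<open>M\<close>, then the lift \<open>F\<close> of \<open>c\<close> differs from that of \<open>M\<close>
  by the boundary of an edge chain \<open>L\<close>. Then \<open>G\<close> differs from the differential of \<open>L\<close> by an edge chain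
  without boundary, a multiple of the fundamental cycle. This lives in top degree, so it contributes
  nothing to the differential of \<open>G\<close>.
\<close>

lemma winding_boundary:
  assumes s: "sign_assignment {..<n} s" and w: "winding n s i c a"
    and c: "c \<in> boundary_space (bold_basis {..<n} (cycle_edges n) (i - 1)) (bold_diff {..<n} (cycle_edges n) s)"
  shows "a = 0"
proof -
  let ?V = "{..<n}" and ?E = "cycle_edges n"
  let ?d = "cube_diff ?V s :: (nat set \<Rightarrow> 'a) \<Rightarrow> nat set \<Rightarrow> 'a"
  obtain F G where FG: "vertex_family ?V i F" "represents ?V ?E c F"
      "edge_family n (i + 1) G" "\<And>v. ?d (F v) = edge_bd n G v" "?d (G 0) ?V = a"
    using w unfolding winding_def by blast
  obtain b where b: "c = lin_extend (bold_diff ?V ?E s) b" "Poly_Mapping.keys b \<subseteq> bold_basis ?V ?E (i - 1)"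
    using c by (auto simp: boundary_space_def)
  obtain M where M: "vertex_family ?V (i - 1) M" "represents ?V ?E b M"
    using bold_chain_lift [OF sym_cycle_edges _ b(2)] by auto
  have "represents ?V ?E c (\<lambda>v. ?d (M v))"
    unfolding b(1) by (rule represents_bold_diff [OF sym_cycle_edges finite_lessThan M(2,1)])
  from represents_diff [OF FG(2) this] have "represents ?V ?E 0 (\<lambda>v S. F v S - ?d (M v) S)" by simp
  moreover have "vertex_family ?V i (\<lambda>v S. F v S - ?d (M v) S)"
    using FG(1) vertex_family_cube_diff [OF finite_lessThan M(1), of s]
    by (simp add: vertex_family_def supported_diff)
  ultimately obtain L where L: "edge_family n i L" "(\<lambda>v S. F v S - ?d (M v) S) = edge_bd n L"
    using represents_0_imp_edge_bd by blast
  have dF: "edge_bd n G v S = edge_bd n (\<lambda>j. ?d (L j)) v S" for v S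
  proof -
    have "edge_bd n (\<lambda>j. ?d (L j)) v S = ?d (\<lambda>S. F v S - ?d (M v) S) S"
      by (simp add: L(2) [THEN fun_cong] cube_diff_edge_bd)
    also have "\<dots> = ?d (F v) S"
      by (simp add: cube_diff_diff cube_diff_cube_diff [OF finite_lessThan s])
    finally show ?thesis by (simp add: FG(4))
  qed
  define H where "H = (\<lambda>j S. G j S - ?d (L j) S)"
  have H: "edge_family n (i + 1) H"
    using FG(3) edge_family_cube_diff [OF L(1), of s] by (simp add: H_def edge_family_def supported_diff)
  have bdH: "edge_bd n H v S = 0" for v S
    using dF unfolding H_def edge_bd_diff by simp
  have "?d (H 0) ?V = 0"
    unfolding cube_diff_def
  proof (intro sum.neutral ballI)
    fix S assume "S \<in> {S. colour_step ?V S ?V}"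
    hence "S \<noteq> ?V" by (auto simp: colour_step_def)
    hence "H 0 S = 0" using edge_bd_eq_0_imp_top [OF H bdH] by blast
    thus "bit_sign (s S ?V) * H 0 S = 0" by simp
  qed
  moreover have "?d (H 0) ?V = a"
    unfolding H_def by (simp add: cube_diff_diff cube_diff_cube_diff [OF finite_lessThan s] FG(5))
  ultimately show ?thesis by simp
qed

text \<open>
  This is where the cycle needs three vertices. For \<open>n = 2\<close> an edge would occupy the whole vertex set,
  and the complex belonging to it would not be acyclic.
\<close>

lemma vertex_missed_by_edge:
  fixes n :: nat
  assumes "n \<ge> 3"
  shows "\<exists>w<n. w \<noteq> j \<and> w \<noteq> cyc_succ n j"
proof -
  have "card {j, cyc_succ n j} \<le> 2" by (simp add: card_insert_if)
  hence "\<not> {..<n} \<subseteq> {j, cyc_succ n j}"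
    using card_mono [of "{j, cyc_succ n j}" "{..<n}"] assms by auto
  thus ?thesis by auto
qed

lemma vertex_family_exact:
  assumes n: "(n::nat) \<ge> 3" and s: "sign_assignment {..<n} s" and P: "vertex_family {..<n} i P"
    and closed: "\<And>v. cube_diff {..<n} s (P v) = (\<lambda>_. 0)"
  shows "\<exists>M. vertex_family {..<n} (i - 1) M \<and> (\<forall>v. cube_diff {..<n} s (M v) = P v)"
proof -
  have "\<exists>M. supported {..<n} {v} (i - 1) M \<and> cube_diff {..<n} s M = P v" for v
  proof -
    obtain w where "w < n" "w \<noteq> v" using vertex_missed_by_edge [OF n, of v] by blast
    thus ?thesis using P closed by (intro cube_exact [OF finite_lessThan s, of w]) (auto simp: vertex_family_def)
  qed
  thus ?thesis unfolding vertex_family_def by metis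
qed

lemma edge_family_exact:
  assumes n: "(n::nat) \<ge> 3" and s: "sign_assignment {..<n} s" and K: "edge_family n i K"
    and closed: "\<And>j. cube_diff {..<n} s (K j) = (\<lambda>_. 0)"
  shows "\<exists>L. edge_family n (i - 1) L \<and> (\<forall>j. cube_diff {..<n} s (L j) = K j)"
proof -
  have "\<exists>L. supported {..<n} {j, cyc_succ n j} (i - 1) L \<and> cube_diff {..<n} s L = K j" for j
  proof -
    obtain w where "w < n" "w \<noteq> j" "w \<noteq> cyc_succ n j" using vertex_missed_by_edge [OF n, of j] by blast
    thus ?thesis using K closed by (intro cube_exact [OF finite_lessThan s, of w]) (auto simp: edge_family_def)
  qed
  thus ?thesis unfolding edge_family_def by metis
qed

text \<open>
  If \<open>a = 0\<close>, then the differential of \<open>G\<close> vanishes, and \<open>G\<close> is the differential of some edge chain \<open>L\<close> by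
  exactness. Correcting \<open>F\<close> by the boundary of \<open>L\<close>, which does not change \<open>c\<close>, makes it a cycle, and hence
  the differential of a vertex chain \<open>M\<close>. The image of \<open>M\<close> is a bold chain with differential \<open>c\<close>.
\<close>

lemma winding_0_imp_boundary:
  assumes n: "(n::nat) \<ge> 3" and s: "sign_assignment {..<n} s" and w: "winding n s i c (0 :: 'k::field)"
  shows "c \<in> boundary_space (bold_basis {..<n} (cycle_edges n) (i - 1)) (bold_diff {..<n} (cycle_edges n) s)"
proof -
  let ?V = "{..<n}" and ?E = "cycle_edges n"
  let ?d = "cube_diff ?V s :: (nat set \<Rightarrow> 'k) \<Rightarrow> nat set \<Rightarrow> 'k"
  obtain F G where FG: "vertex_family ?V i F" "represents ?V ?E c F"
      "edge_family n (i + 1) G" "\<And>v. ?d (F v) = edge_bd n G v" "?d (G 0) ?V = 0"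
    using w unfolding winding_def by blast
  define K where "K j = ?d (G j)" for j
  have K: "edge_family n (i + 1 + 1) K"
    unfolding K_def by (rule edge_family_cube_diff [OF FG(3)])
  have bdK: "edge_bd n K v S = 0" for v S
  proof -
    have "edge_bd n K v = ?d (?d (F v))" unfolding K_def FG(4) cube_diff_edge_bd ..
    thus ?thesis by (simp add: cube_diff_cube_diff [OF finite_lessThan s])
  qed
  have "K 0 S = 0" for S
    using edge_bd_eq_0_imp_top [OF K bdK, of S] FG(5) K_def by metis
  hence "K j S = 0" for j S
    using edge_bd_eq_0_imp_constant [of n K S j, OF bdK] edge_family_outside [OF K, of j S] by metis
  hence "?d (G j) = (\<lambda>_. 0)" for j by (auto simp: K_def)
  from edge_family_exact [OF n s FG(3) this] obtain L where
    L: "edge_family n i L" "\<And>j. ?d (L j) = G j" by auto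
  define P where "P = (\<lambda>v S. F v S - edge_bd n L v S)"
  have P: "vertex_family ?V i P"
    using FG(1) vertex_family_edge_bd [OF L(1)] by (simp add: P_def vertex_family_def supported_diff)
  have "?d (P v) = (\<lambda>_. 0)" for v
    by (simp add: P_def fun_eq_iff cube_diff_diff FG(4) cube_diff_edge_bd L(2))
  from vertex_family_exact [OF n s P this] obtain M where
    M: "vertex_family ?V (i - 1) M" "\<And>v. ?d (M v) = P v" by auto
  obtain b where b: "represents ?V ?E b M" using bold_chain_of_family [of ?V ?E M] by auto
  have "represents ?V ?E (lin_extend (bold_diff ?V ?E s) b) P"
    using represents_bold_diff [OF sym_cycle_edges finite_lessThan b M(1), of s] by (simp add: M(2))
  from represents_diff [OF FG(2) this]
  have "represents ?V ?E (c - lin_extend (bold_diff ?V ?E s) b) (edge_bd n L)"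
    by (simp add: P_def)
  hence "c = lin_extend (bold_diff ?V ?E s) b"
    using represents_edge_bd [OF _ L(1)] by fastforce
  moreover have "Poly_Mapping.keys b \<subseteq> bold_basis ?V ?E (i - 1)"
    by (rule keys_represented [OF b M(1)])
  ultimately show ?thesis unfolding boundary_space_def by blast
qed

text \<open>
  The two steps are run backwards from \<open>a\<close> times the fundamental cycle.
\<close>

lemma winding_surjective:
  fixes a :: "'k::field"
  assumes n: "(n::nat) \<ge> 3" and s: "sign_assignment {..<n} s"
  shows "\<exists>c \<in> cycle_space (bold_basis {..<n} (cycle_edges n) (int n - 2)) (bold_diff {..<n} (cycle_edges n) s).
    winding n s (int n - 2) c a"
proof -
  let ?V = "{..<n}" and ?E = "cycle_edges n"
  let ?d = "cube_diff ?V s :: (nat set \<Rightarrow> 'k) \<Rightarrow> nat set \<Rightarrow> 'k"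
  define K where "K j S = (if j < n \<and> S = ?V then a else 0)" for j S
  have K: "edge_family n (int n) K"
    using cyc_succ_less by (auto simp: edge_family_def supported_def K_def)
  have "?d (K j) T = 0" for j T
    unfolding cube_diff_def
    by (intro sum.neutral) (auto simp: K_def colour_step_def)
  hence "?d (K j) = (\<lambda>_. 0)" for j by auto
  from edge_family_exact [OF n s K this] obtain G where
    G: "edge_family n (int n - 1) G" "\<And>j. ?d (G j) = K j" by auto
  have P: "vertex_family ?V (int n - 1) (edge_bd n G)" by (rule vertex_family_edge_bd [OF G(1)])
  have "edge_bd n K v S = 0" for v S using cyc_pred_less [of v n] by (auto simp: edge_bd_def K_def)
  hence "?d (edge_bd n G v) = (\<lambda>_. 0)" for v by (auto simp: cube_diff_edge_bd G(2))
  from vertex_family_exact [OF n s P this] obtain F where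
    F: "vertex_family ?V (int n - 2) F" "\<And>v. ?d (F v) = edge_bd n G v" by auto
  obtain c where c: "represents ?V ?E c F" using bold_chain_of_family [of ?V ?E F] by auto
  have "represents ?V ?E (lin_extend (bold_diff ?V ?E s) c) (edge_bd n G)"
    using represents_bold_diff [OF sym_cycle_edges finite_lessThan c F(1), of s] by (simp add: F(2))
  hence "lin_extend (bold_diff ?V ?E s) c = 0" by (rule represents_edge_bd [OF _ G(1)])
  hence "c \<in> cycle_space (bold_basis ?V ?E (int n - 2)) (bold_diff ?V ?E s)"
    using keys_represented [OF c F(1)] by (simp add: cycle_space_def)
  moreover have "winding n s (int n - 2) c a"
    unfolding winding_def
    using F c G n by (intro exI [of _ F] exI [of _ G]) (simp add: K_def)
  ultimately show ?thesis by blast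
qed

lemma bold_homology_cycle_graph:
  assumes n: "(n::nat) \<ge> 3" and s: "sign_assignment {..<n} s"
  shows "\<exists>\<psi>. homology_functional
    (bold_basis {..<n} (cycle_edges n) (i - 1)) (bold_diff {..<n} (cycle_edges n) s)
    (bold_basis {..<n} (cycle_edges n) i) (bold_diff {..<n} (cycle_edges n) s)
    \<psi> (if i = int n - 2 then UNIV else {0 :: 'k::field})"
proof (rule homology_functional_of_relation [where R = "winding n s i"])
  let ?Z = "cycle_space (bold_basis {..<n} (cycle_edges n) i) (bold_diff {..<n} (cycle_edges n) s)
    :: (_ \<Rightarrow>\<^sub>0 'k) set"
  show "boundary_space (bold_basis {..<n} (cycle_edges n) (i - 1)) (bold_diff {..<n} (cycle_edges n) s) \<subseteq> ?Z"
    by (rule bold_boundaries_subset_cycles [OF sym_cycle_edges finite_lessThan s])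
  show "a \<in> (if i = int n - 2 then UNIV else {0}) \<longleftrightarrow> (\<exists>c\<in>?Z. winding n s i c a)" for a
  proof (cases "i = int n - 2")
    case True
    thus ?thesis using winding_surjective [OF n s, of a] by auto
  next
    case False
    have "\<exists>c\<in>?Z. winding n s i c 0"
      using winding_exists [OF cycle_space_0] winding_degree False cycle_space_0 by metis
    moreover have "a = 0" if "winding n s i c a" for c
      using winding_degree [OF that] False by blast
    ultimately show ?thesis using False by auto
  qed
  show "a = 0 \<longleftrightarrow> c \<in> boundary_space (bold_basis {..<n} (cycle_edges n) (i - 1))
      (bold_diff {..<n} (cycle_edges n) s)" if "winding n s i c a" for c a
    using that winding_boundary [OF s that] winding_0_imp_boundary [OF n s, of i c] by metis
qed (fact winding_exists winding_add winding_scale)+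


theorem proposition5p6:
  fixes n :: nat
    and s :: "nat set \<Rightarrow> nat set \<Rightarrow> bit"
  assumes "n \<ge> 3"
    and "sign_assignment {..<n} s"
  shows "\<forall>i::int. lin_isomorphic
           (bold_homology {..<n} (cycle_edges n) s i
             :: ('k::field, (nat set \<times> nat set \<Rightarrow>\<^sub>0 'k) set) module)
           (reduced_singular_homology (int n - 1 - i) (nsphere 1))"
proof
  fix i :: int
  obtain \<psi> where "homology_functional
      (bold_basis {..<n} (cycle_edges n) (i - 1)) (bold_diff {..<n} (cycle_edges n) s)
      (bold_basis {..<n} (cycle_edges n) i) (bold_diff {..<n} (cycle_edges n) s)
      \<psi> (if i = int n - 2 then UNIV else {0 :: 'k})"
    using bold_homology_cycle_graph [OF assms] by blast
  moreover obtain \<phi> where "homology_functional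
      (singular_basis (nsphere 1) (int n - 1 - i + 1)) (singular_bd (int n - 1 - i + 1))
      (singular_basis (nsphere 1) (int n - 1 - i)) (singular_bd (int n - 1 - i))
      \<phi> (if int n - 1 - i = int 1 then UNIV else {0 :: 'k})"
    using field_homology_nsphere [of 1 "int n - 1 - i"] by blast
  moreover have "int n - 1 - i = int 1 \<longleftrightarrow> i = int n - 2" by auto
  ultimately show "lin_isomorphic
      (bold_homology {..<n} (cycle_edges n) s i :: ('k, (nat set \<times> nat set \<Rightarrow>\<^sub>0 'k) set) module)
      (reduced_singular_homology (int n - 1 - i) (nsphere 1))"
    unfolding bold_homology_def reduced_singular_homology_def
    by (simp only: lin_isomorphic_if_same_range)
qed

end
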